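(* There is a deterministic algorithm which, given $f\in\mathbb{Z}[x]$ in lacunary representation with exactly $t\ge 2$ nonzero terms, and $r,\mu\in\mathbb{N}$, returns a polynomial $h\in\mathbb{Z}[x]$ (in lacunary representation) such that $f=h^r$ and $\tau(h)\le\mu$, provided such an $h$ exists (and otherwise reports that $f$ is not an $r$th power of a $\mu$-sparse polynomial), and which requires a number of bit operations polynomial in $t=\tau(f)$, $\log\deg f$, $\log\|f\|_\infty$ and $\mu$.
   Context: For a polynomial $g$, $\tau(g)$ is its number of nonzero terms; $g$ is $\mu$-sparse if $\tau(g)\le\mu$. The lacunary representation of $f=\sum_{i=1}^t c_ix^{e_i}$ ($c_i\ne0$, $0\le e_1<\dots<e_t=\deg f$) is the list of pairs $(c_i,e_i)$. $\|f\|_\infty=\max_i|c_i|$. *)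

theory Defs
  imports Complex_Main "HOL-Computational_Algebra.Polynomial" "HOL-Library.Log_Nat"
begin

definition num_terms :: "'a::zero poly \<Rightarrow> nat" where
  "num_terms g = card {i. coeff g i \<noteq> 0}"

definition sparse :: "nat \<Rightarrow> 'a::zero poly \<Rightarrow> bool" where
  "sparse \<mu> g \<longleftrightarrow> num_terms g \<le> \<mu>"

definition lacunary :: "'a::zero poly \<Rightarrow> ('a \<times> nat) list" where
  "lacunary g = map (\<lambda>e. (coeff g e, e)) (sorted_list_of_set {i. coeff g i \<noteq> 0})"

(* The maximum also ranges over zero coefficients, which does not change its value. *)
definition max_norm :: "int poly \<Rightarrow> int" where
  "max_norm g = Max ((\<lambda>i. \<bar>coeff g i\<bar>) ` {..degree g})"


(* Model of computation: structured programs over a random access machine, with every operation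
   charged by the bit lengths of the integers it touches.  A program is a finite object of type
   com and so mentions only finitely many registers and arrays; these hold arbitrary integers. *)

type_synonym reg = nat
type_synonym arr = nat

record state =
  regs :: "reg \<Rightarrow> int"
  arrs :: "arr \<Rightarrow> int \<Rightarrow> int"

datatype binop = Add | Sub | Mul | Div

datatype com =
    Skip
  | Const reg int
  | Op binop reg reg reg
  | Load reg arr reg
  | Store arr reg reg
  | Seq com com
  | IfLess reg reg com com
  | WhileLess reg reg com

(* Binary length of the absolute value, plus one for the sign. *)
definition bits :: "int \<Rightarrow> nat" where
  "bits x = floorlog 2 (nat \<bar>x\<bar>) + 1"

fun op_val :: "binop \<Rightarrow> int \<Rightarrow> int \<Rightarrow> int" where
  "op_val Add x y = x + y"
| "op_val Sub x y = x - y"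
| "op_val Mul x y = x * y"
| "op_val Div x y = x div y"

(* Up to constant factors, the bit operations used by the schoolbook algorithms. *)
fun op_cost :: "binop \<Rightarrow> int \<Rightarrow> int \<Rightarrow> nat" where
  "op_cost Add x y = bits x + bits y"
| "op_cost Sub x y = bits x + bits y"
| "op_cost Mul x y = bits x * bits y"
| "op_cost Div x y = bits x * bits y"

(* Comparison scans both numbers in parallel from the least significant bit and stops at the end
   of the shorter one: if the lengths differ, they and the signs already decide. *)
definition less_cost :: "int \<Rightarrow> int \<Rightarrow> nat" where
  "less_cost x y = min (bits x) (bits y)"

(* exec c s n s': started in s, the program c halts in s' after n bit operations. *)
inductive exec :: "com \<Rightarrow> state \<Rightarrow> nat \<Rightarrow> state \<Rightarrow> bool" where
  Skip: "exec Skip s 1 s"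
| Const: "exec (Const x v) s (bits v) (s\<lparr>regs := (regs s)(x := v)\<rparr>)"
| Op: "exec (Op b x y z) s (op_cost b (regs s y) (regs s z))
         (s\<lparr>regs := (regs s)(x := op_val b (regs s y) (regs s z))\<rparr>)"
| Load: "exec (Load x a i) s (bits (regs s i) + bits (arrs s a (regs s i)))
           (s\<lparr>regs := (regs s)(x := arrs s a (regs s i))\<rparr>)"
| Store: "exec (Store a i x) s (bits (regs s i) + bits (regs s x))
            (s\<lparr>arrs := (arrs s)(a := (arrs s a)(regs s i := regs s x))\<rparr>)"
| Seq: "\<lbrakk>exec c1 s m s'; exec c2 s' n s''\<rbrakk> \<Longrightarrow> exec (Seq c1 c2) s (m + n) s''"
| IfTrue: "\<lbrakk>regs s x < regs s y; exec c1 s n s'\<rbrakk>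
            \<Longrightarrow> exec (IfLess x y c1 c2) s (less_cost (regs s x) (regs s y) + n) s'"
| IfFalse: "\<lbrakk>\<not> regs s x < regs s y; exec c2 s n s'\<rbrakk>
            \<Longrightarrow> exec (IfLess x y c1 c2) s (less_cost (regs s x) (regs s y) + n) s'"
| WhileFalse: "\<not> regs s x < regs s y
            \<Longrightarrow> exec (WhileLess x y c) s (less_cost (regs s x) (regs s y)) s"
| WhileTrue: "\<lbrakk>regs s x < regs s y; exec c s m s'; exec (WhileLess x y c) s' n s''\<rbrakk>
            \<Longrightarrow> exec (WhileLess x y c) s (less_cost (regs s x) (regs s y) + m + n) s''"

inductive_cases SkipE: "exec Skip s n t"
inductive_cases ConstE: "exec (Const x v) s n t"
inductive_cases OpE: "exec (Op b x y z) s n t"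
inductive_cases LoadE: "exec (Load x a i) s n t"
inductive_cases StoreE: "exec (Store a i x) s n t"
inductive_cases SeqE: "exec (Seq c1 c2) s n t"
inductive_cases IfLessE: "exec (IfLess x y c1 c2) s n t"
inductive_cases WhileLessE: "exec (WhileLess x y c) s n t"

lemma exec_deterministic:
  "exec c s n t \<Longrightarrow> exec c s n' t' \<Longrightarrow> n' = n \<and> t' = t"
proof (induction arbitrary: n' t' rule: exec.induct)
  case Skip then show ?case by (auto elim: SkipE)
next
  case Const then show ?case by (auto elim: ConstE)
next
  case Op then show ?case by (auto elim: OpE)
next
  case Load then show ?case by (auto elim: LoadE)
next
  case Store then show ?case by (auto elim: StoreE)
next
  case Seq then show ?case by (blast elim: SeqE)
next
  case IfTrue then show ?case by (blast elim: IfLessE)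
next
  case IfFalse then show ?case by (blast elim: IfLessE)
next
  case WhileFalse then show ?case by (blast elim: WhileLessE)
next
  case WhileTrue
  from WhileTrue.prems show ?case
    by (rule WhileLessE) (use WhileTrue.hyps(1) WhileTrue.IH in blast)+
qed

(* Input: registers 0, 1, 2 hold the number of terms, r and mu; arrays 0 and 1 hold the
   coefficients and the exponents.  Everything else is zero. *)
definition input_state :: "(int \<times> nat) list \<Rightarrow> nat \<Rightarrow> nat \<Rightarrow> state" where
  "input_state cs r \<mu> = \<lparr>
     regs = (\<lambda>_. 0)(0 := int (length cs), 1 := int r, 2 := int \<mu>),
     arrs = (\<lambda>_ _. 0)(
       0 := (\<lambda>i. if 0 \<le> i \<and> i < int (length cs) then fst (cs ! nat i) else 0),
       1 := (\<lambda>i. if 0 \<le> i \<and> i < int (length cs) then int (snd (cs ! nat i)) else 0))\<rparr>"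

(* Output: register 3 holds the number of terms, arrays 2 and 3 the coefficients and exponents;
   a value of -1 in register 3 reports that there is no root. *)
definition returns :: "state \<Rightarrow> (int \<times> nat) list \<Rightarrow> bool" where
  "returns s cs \<longleftrightarrow> regs s 3 = int (length cs) \<and>
     (\<forall>i<length cs. arrs s 2 (int i) = fst (cs ! i) \<and> arrs s 3 (int i) = int (snd (cs ! i)))"

definition reports_failure :: "state \<Rightarrow> bool" where
  "reports_failure s \<longleftrightarrow> regs s 3 = -1"

end

theory Submission
  imports Defs
begin

text \<open>Let \<open>\<theta> = x d/dx\<close>. If \<open>f = h ^ r\<close> then \<open>r f \<theta>(h) - h \<theta>(f) = 0\<close>, which is linear in \<open>h\<close>;
  conversely a solution \<open>h\<close> whose lowest term is an \<open>r\<close>th root of that of \<open>f\<close> satisfies \<open>f = h ^ r\<close>,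
  since \<open>f / h ^ r\<close> has derivative zero. The lowest term of \<open>h\<close> is found by bisection.
  If \<open>g\<close> consists of the \<open>k\<close> lowest terms of \<open>h\<close>, the lowest term of the residual
  \<open>r f \<theta>(g) - g \<theta>(f)\<close>, which has at most \<open>k t\<close> terms, determines the next term of \<open>h\<close> by one division.
  When the residual vanishes, \<open>f = g ^ r\<close> needs no further verification.
  A failing division, or a nonzero residual after \<open>\<mu>\<close> terms, refutes the existence of a root.
  The coefficients gain a bounded number of factors from \<open>t\<close>, \<open>deg f\<close>, \<open>max_norm f\<close>, \<open>\<mu>\<close> per step, so their
  bit length stays polynomial even if there is no root. Finally \<open>r < t\<close> by Hajos' lemma.\<close>

subsection \<open>The differential equation of a power\<close>

text \<open>The cost bound involves neither \<open>r\<close> nor a promise that a root exists, and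
  both facts shape the proof. The bit length of \<open>r\<close> is uncontrolled, so until
  \<open>r < t\<close> is known the program may only compare \<open>r\<close>, at the price of the
  shorter operand. Without a root the candidate terms belong to no polynomial of known size, so size
  bounds for roots of \<open>f\<close> are of no help; all sizes are therefore tracked as powers of
  one number \<open>A\<close>. Partial roots accordingly satisfy two kinds of conditions:
  unconditional ones (the order of the residual grows with every term, the exponents stay bounded)
  and one quantified over all roots with the chosen lowest term (they share the terms found so far).
  Fixing that lowest term is harmless, since roots differ at most by a sign. Because the residual is
  additive in \<open>h\<close>, a new term costs \<open>t\<close> new list entries and the
  polynomial power \<open>h ^ r\<close> is never expanded. The final degree 9 is 4 + 5: with one
  parameter \<open>Y\<close> for the input size, operands have O(\<open>Y ^ 2\<close>) bits, so an
  operation costs O(\<open>Y ^ 4\<close>), and about \<open>\<mu>\<close> quadratic searches in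
  lists of at most \<open>\<mu> * t\<close> entries take O(\<open>Y ^ 5\<close>) operations.\<close>

definition euler :: "'a::{idom,ring_char_0} poly \<Rightarrow> 'a poly" where
  "euler p = pCons 0 (pderiv p)"

lemma coeff_euler: "coeff (euler p) n = of_nat n * coeff p n"
  by (cases n) (auto simp: euler_def coeff_pderiv)

lemma euler_eq: "euler p = [:0, 1:] * pderiv p"
  by (simp add: euler_def)

lemma euler_add: "euler (p + q) = euler p + euler q"
  by (rule poly_eqI) (simp add: coeff_euler algebra_simps)

lemma euler_diff: "euler (p - q) = euler p - euler q"
  by (rule poly_eqI) (simp add: coeff_euler algebra_simps)

lemma euler_mult: "euler (p * q) = euler p * q + p * euler q"
  unfolding euler_eq pderiv_mult by (simp only: algebra_simps)

lemma euler_monom: "euler (monom a n) = monom (of_nat n * a) n"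
  by (rule poly_eqI) (simp add: coeff_euler)

text \<open>Multiplication by \<open>h\<close> avoids the exponent \<open>r - 1\<close>, so
  \<open>r = 0\<close> fits in.\<close>

lemma euler_power: "h * euler (h ^ r) = of_nat r * (h ^ r * euler h)"
proof (induction r)
  case 0
  have "euler (1 :: 'a poly) = 0"
    by (rule poly_eqI) (auto simp: coeff_euler)
  then show ?case by simp
next
  case (Suc r)
  have "h * euler (h ^ Suc r) = h * (euler h * h ^ r) + h * (h * euler (h ^ r))"
    by (simp add: euler_mult algebra_simps)
  also have "h * (h * euler (h ^ r)) = h * (of_nat r * (h ^ r * euler h))"
    by (simp only: Suc.IH)
  finally show ?case by (simp add: algebra_simps)
qed

text \<open>For nonzero \<open>f\<close> and \<open>h\<close> this is \<open>f * h\<close> times the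
  logarithmic derivative of \<open>h ^ r / f\<close> with respect to \<open>euler\<close>. It is
  additive in \<open>f\<close> and in \<open>h\<close> separately, and both are exploited.\<close>

definition resid :: "'a::{idom,ring_char_0} poly \<Rightarrow> nat \<Rightarrow> 'a poly \<Rightarrow> 'a poly" where
  "resid f r h = of_nat r * (f * euler h) - h * euler f"

lemma resid_add: "resid f r (g + h) = resid f r g + resid f r h"
  by (simp add: resid_def euler_add algebra_simps)

lemma resid_diff: "resid f r (g - h) = resid f r g - resid f r h"
  by (simp add: resid_def euler_diff algebra_simps)

lemma resid_power: "resid (h ^ r) r h = 0"
  by (simp add: resid_def euler_power)

lemma resid_monom_monom:
  "resid (monom c e) r (monom b d) = monom (c * b * (of_nat r * of_nat d - of_nat e)) (e + d)"
  by (simp add: resid_def euler_monom mult_monom of_nat_poly smult_monom algebra_simps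
      diff_monom add_monom)

lemma resid_add_left: "resid (f + g) r h = resid f r h + resid g r h"
  by (simp add: resid_def euler_add algebra_simps)

lemma resid_0_left [simp]: "resid 0 r h = 0"
  by (simp add: resid_def euler_def)

lemma resid_0_right [simp]: "resid f r 0 = 0"
  by (simp add: resid_def euler_def)

section \<open>Lowest terms and the residual equation\<close>

definition low :: "nat \<Rightarrow> 'a::zero poly \<Rightarrow> bool" where
  "low d p \<longleftrightarrow> (\<forall>i<d. coeff p i = 0)"

lemma low_exists:
  assumes "p \<noteq> 0"
  obtains d where "low d p" "coeff p d \<noteq> 0"
proof -
  let ?d = "LEAST i. coeff p i \<noteq> 0"
  have "\<exists>i. coeff p i \<noteq> 0" using assms by (metis leading_coeff_0_iff)
  then have "coeff p ?d \<noteq> 0" by (rule LeastI_ex)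
  moreover have "low ?d p" unfolding low_def using not_less_Least by blast
  ultimately show ?thesis using that by blast
qed

lemma low_mult:
  assumes "low a p" "low b q"
  shows "low (a + b) (p * q)" "coeff (p * q) (a + b) = coeff p a * coeff q b"
proof -
  show "low (a + b) (p * q)"
    unfolding low_def coeff_mult
  proof (intro allI impI sum.neutral ballI)
    fix n i assume "n < a + b" "i \<in> {..n}"
    then have "i < a \<or> n - i < b" by auto
    then show "coeff p i * coeff q (n - i) = 0" using assms by (auto simp: low_def)
  qed
  have "coeff p i * coeff q (a + b - i) = 0" if "i \<noteq> a" "i \<le> a + b" for i
  proof -
    have "i < a \<or> a + b - i < b" using that by auto
    then show ?thesis using assms by (auto simp: low_def)
  qed
  then have "(\<Sum>i\<le>a + b. coeff p i * coeff q (a + b - i))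
      = (\<Sum>i\<in>{a}. coeff p i * coeff q (a + b - i))"
    by (intro sum.mono_neutral_right) auto
  then show "coeff (p * q) (a + b) = coeff p a * coeff q b" by (simp add: coeff_mult)
qed

lemma low_power:
  assumes "low d h"
  shows "low (r * d) (h ^ r) \<and> coeff (h ^ r) (r * d) = coeff h d ^ r"
proof (induction r)
  case (Suc r)
  with low_mult[OF assms, of "r * d" "h ^ r"] show ?case by simp
qed (simp add: low_def)

lemma low_euler: "low d p \<Longrightarrow> low d (euler p)"
  by (simp add: low_def coeff_euler)

text \<open>Both products in \<open>resid\<close> start at the exponent \<open>e + d\<close>. The
  remaining factor \<open>r * d - e\<close> acts as an indicial polynomial: the two lowest terms
  cancel only if \<open>d\<close> is the lowest exponent expected of an \<open>r\<close>th
  root.\<close>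

lemma low_resid:
  assumes "low e f" "low d h"
  shows "low (e + d) (resid f r h)"
    and "coeff (resid f r h) (e + d)
      = coeff f e * coeff h d * (of_nat r * of_nat d - of_nat e)"
proof -
  note 1 = low_mult[OF assms(1) low_euler[OF assms(2)]]
  note 2 = low_mult[OF assms(2) low_euler[OF assms(1)]]
  show "low (e + d) (resid f r h)"
    using 1(1) 2(1)
    by (auto simp: low_def resid_def of_nat_poly add.commute)
  show "coeff (resid f r h) (e + d)
      = coeff f e * coeff h d * (of_nat r * of_nat d - of_nat e)"
    using 1(2) 2(2)
    by (simp add: resid_def of_nat_poly add.commute coeff_euler algebra_simps)
qed

lemma resid_eq_0_low:
  assumes "resid f r h = 0" "low e f" "coeff f e \<noteq> 0" "low d h" "coeff h d \<noteq> 0"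
  shows "r * d = e"
proof -
  have "of_nat (r * d) = (of_nat e :: 'a)"
    using low_resid(2)[OF assms(2,4), of r] assms by simp
  then show ?thesis by (simp only: of_nat_eq_iff)
qed

text \<open>The quotient argument without quotients: \<open>f\<close> and \<open>h ^ r\<close> both
  solve the equation \<open>resid f 1 v = 0\<close>, hence so does their difference
  \<open>u\<close>. A nonzero solution starts at the exponent \<open>r * d\<close>, but there the
  terms of \<open>f\<close> and \<open>h ^ r\<close> cancel.\<close>

lemma resid_eq_0_imp_power:
  assumes "resid f r h = 0" "low (r * d) f" "coeff f (r * d) \<noteq> 0" "low d h"
    and "coeff h d ^ r = coeff f (r * d)" "0 < r"
  shows "f = h ^ r"
proof (rule ccontr)
  assume "f \<noteq> h ^ r"
  define u where "u = f - h ^ r"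
  have "u \<noteq> 0" using \<open>f \<noteq> h ^ r\<close> by (simp add: u_def)
  then obtain m where m: "low m u" "coeff u m \<noteq> 0" by (rule low_exists)
  have h: "h \<noteq> 0" using assms by (auto simp: power_0_left)
  have "h * (f * euler (h ^ r)) = f * (h * euler (h ^ r))" by (simp add: algebra_simps)
  also have "\<dots> = h ^ r * (of_nat r * (f * euler h))" by (simp add: euler_power algebra_simps)
  also have "\<dots> = h ^ r * (h * euler f)" using assms(1) by (simp add: resid_def)
  finally have "h * (f * euler (h ^ r)) = h * (h ^ r * euler f)" by (simp add: algebra_simps)
  then have "f * euler (h ^ r) = h ^ r * euler f" using h by simp
  then have "resid f 1 (h ^ r) = 0" by (simp add: resid_def)
  then have "resid f 1 u = 0" by (simp add: u_def resid_diff) (simp add: resid_def)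
  then have "1 * m = r * d" by (rule resid_eq_0_low[OF _ assms(2,3) m])
  moreover have "coeff u (r * d) = 0" using low_power[OF assms(4), of r] assms(5) by (simp add: u_def)
  ultimately show False using m(2) by simp
qed

text \<open>Since \<open>resid f r h = 0\<close>, the residual of a truncation \<open>g\<close> is
  minus that of the missing tail \<open>h - g\<close>. Its lowest term thus comes from the lowest
  terms of \<open>f\<close> and of the tail alone, which is an equation for the next coefficient of
  \<open>h\<close>.\<close>

lemma resid_next_term:
  assumes f: "f = h ^ r" "low d0 h" "coeff h d0 \<noteq> 0" "0 < r"
    and agree: "d0 \<le> d" "\<And>n. n \<le> d \<Longrightarrow> coeff g n = coeff h n" "\<And>n. d < n \<Longrightarrow> coeff g n = 0"
  shows "resid f r g = 0 \<Longrightarrow> g = h"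
    and "low N (resid f r g) \<Longrightarrow> coeff (resid f r g) N \<noteq> 0 \<Longrightarrow>
      \<exists>d'>d. N = r * d0 + d' \<and> low d' (h - g) \<and> coeff h d' \<noteq> 0 \<and>
        - coeff (resid f r g) N
          = coeff h d' * (coeff f (r * d0) * (of_nat r * of_nat d' - of_nat (r * d0)))"
proof -
  define u where "u = h - g"
  have res: "resid f r g = - resid f r u" unfolding u_def resid_diff f(1) resid_power by simp
  note lf = low_power[OF f(2), of r, folded f(1)]
  have main: "\<exists>d'>d. low d' u \<and> coeff u d' \<noteq> 0 \<and> coeff u d' = coeff h d' \<and> low (r * d0 + d') (resid f r g) \<and>
      - coeff (resid f r g) (r * d0 + d')
        = coeff u d' * (coeff f (r * d0) * (of_nat r * of_nat d' - of_nat (r * d0))) \<and>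
      coeff (resid f r g) (r * d0 + d') \<noteq> 0" if u: "u \<noteq> 0"
  proof -
    obtain d' where d': "low d' u" "coeff u d' \<noteq> 0" using u by (rule low_exists)
    have "d < d'" using d' agree(2)[of d'] by (force simp: u_def not_le)
    then have "coeff u d' = coeff h d'" using agree(3) by (simp add: u_def)
    \<comment> \<open>The tail lies strictly above \<open>d0\<close>, so the indicial factor cannot
      vanish and the next term of \<open>h\<close> is visible in the residual.\<close>
    have "r * d' \<noteq> r * d0" using \<open>d < d'\<close> agree(1) f(4) by simp
    then have "of_nat (r * d') \<noteq> (of_nat (r * d0) :: 'a)" by (simp only: of_nat_eq_iff not_False_eq_True)
    then have ne: "of_nat r * of_nat d' - of_nat (r * d0) \<noteq> (0 :: 'a)" by simp
    have fe: "coeff f (r * d0) \<noteq> 0" using lf f(3) by simp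
    note lr = low_resid[OF conjunct1[OF lf] d'(1), of r]
    have "low (r * d0 + d') (resid f r g)" using lr(1) by (simp add: res low_def)
    moreover have "- coeff (resid f r g) (r * d0 + d')
        = coeff u d' * (coeff f (r * d0) * (of_nat r * of_nat d' - of_nat (r * d0)))"
      using lr(2) by (simp add: res algebra_simps)
    moreover have "coeff (resid f r g) (r * d0 + d') \<noteq> 0"
      using lr(2) ne fe d'(2) by (simp add: res)
    ultimately show ?thesis using \<open>d < d'\<close> \<open>coeff u d' = coeff h d'\<close> d' by blast
  qed
  show "g = h" if "resid f r g = 0"
  proof (rule ccontr)
    assume "g \<noteq> h"
    then have "u \<noteq> 0" by (auto simp: u_def)
    from main[OF this] that show False by auto
  qed
  show "\<exists>d'>d. N = r * d0 + d' \<and> low d' (h - g) \<and> coeff h d' \<noteq> 0 \<and>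
        - coeff (resid f r g) N
          = coeff h d' * (coeff f (r * d0) * (of_nat r * of_nat d' - of_nat (r * d0)))"
    if N: "low N (resid f r g)" "coeff (resid f r g) N \<noteq> 0"
  proof -
    have "u \<noteq> 0" using N(2) by (auto simp: res)
    from main[OF this] obtain d' where d': "d < d'" "low d' u" "coeff u d' \<noteq> 0" "coeff u d' = coeff h d'"
      "low (r * d0 + d') (resid f r g)"
      "- coeff (resid f r g) (r * d0 + d')
        = coeff u d' * (coeff f (r * d0) * (of_nat r * of_nat d' - of_nat (r * d0)))"
      "coeff (resid f r g) (r * d0 + d') \<noteq> 0" by blast
    have "N = r * d0 + d'" using d'(5,7) N by (metis low_def nat_neq_iff)
    with d' show ?thesis unfolding u_def by auto
  qed
qed

section \<open>Numbers of terms and Hajos' bound on the exponent\<close>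

lemma finite_coeffs: "finite {i. coeff p i \<noteq> 0}"
  by (rule finite_subset[of _ "{..degree p}"]) (auto intro: le_degree)

lemma num_terms_eq_0_iff: "num_terms p = 0 \<longleftrightarrow> p = 0"
  by (auto simp: num_terms_def card_eq_0_iff finite_coeffs poly_eq_iff)

text \<open>Turns "at least two terms" into a gap between lowest exponent and degree. Over a domain
  both ends are additive under multiplication, so products and powers are easy to treat.\<close>

lemma two_le_num_terms_iff:
  assumes "low d p" "coeff p d \<noteq> 0"
  shows "2 \<le> num_terms p \<longleftrightarrow> d < degree p"
proof
  assume "2 \<le> num_terms p"
  show "d < degree p"
  proof (rule ccontr)
    assume "\<not> d < degree p"
    then have "{i. coeff p i \<noteq> 0} \<subseteq> {d}"
      using assms by (auto simp: low_def) (metis le_degree le_trans linorder_neqE_nat not_le)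
    then have "num_terms p \<le> 1" unfolding num_terms_def by (metis card.empty card.insert card_mono empty_iff finite.intros One_nat_def)
    with \<open>2 \<le> num_terms p\<close> show False by simp
  qed
next
  assume *: "d < degree p"
  then have "{d, degree p} \<subseteq> {i. coeff p i \<noteq> 0}" using assms by auto
  from card_mono[OF finite_coeffs this] * show "2 \<le> num_terms p" by (simp add: num_terms_def)
qed

lemma two_le_num_terms_mult:
  fixes h q :: "'a::idom poly"
  assumes "2 \<le> num_terms h" "q \<noteq> 0"
  shows "2 \<le> num_terms (h * q)"
proof -
  have h: "h \<noteq> 0" using assms(1) num_terms_eq_0_iff[of h] by auto
  obtain a where a: "low a h" "coeff h a \<noteq> 0" using low_exists[OF h] .
  obtain b where b: "low b q" "coeff q b \<noteq> 0" using low_exists[OF assms(2)] .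
  have "a < degree h" using two_le_num_terms_iff[OF a] assms(1) by simp
  moreover have "b \<le> degree q" using b(2) by (rule le_degree)
  ultimately have "a + b < degree (h * q)" using h assms(2) by (simp add: degree_mult_eq)
  then show ?thesis using two_le_num_terms_iff[of "a + b" "h * q"] low_mult[OF a(1) b(1)] a b by simp
qed

lemma two_le_num_terms_power:
  fixes h :: "'a::idom poly"
  assumes "2 \<le> num_terms (h ^ r)"
  shows "2 \<le> num_terms h" "0 < r"
proof -
  show "0 < r"
  proof (rule ccontr)
    assume "\<not> 0 < r"
    moreover have "low 0 (1 :: 'a poly)" "coeff (1 :: 'a poly) 0 \<noteq> 0" by (auto simp: low_def)
    ultimately show False using two_le_num_terms_iff[of 0 "1 :: 'a poly"] assms by simp
  qed
  have h: "h \<noteq> 0" using assms \<open>0 < r\<close> num_terms_eq_0_iff[of "h ^ r"] by (auto simp: power_0_left)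
  obtain a where a: "low a h" "coeff h a \<noteq> 0" using low_exists[OF h] .
  have "r * a < degree (h ^ r)"
    using two_le_num_terms_iff[of "r * a" "h ^ r"] low_power[OF a(1), of r] a(2) assms by simp
  also have "degree (h ^ r) \<le> degree h * r" by (rule degree_power_le)
  finally have "a < degree h" using \<open>0 < r\<close> by (simp add: mult.commute)
  then show "2 \<le> num_terms h" using two_le_num_terms_iff[OF a] by simp
qed

text \<open>Hajos' argument: the operator \<open>g \<mapsto> x g' - e g\<close>, where \<open>e\<close> is the lowest exponent of \<open>g\<close>,
  removes exactly one term and lowers the multiplicity of \<open>h\<close> by at most one.\<close>

lemma less_num_terms_if_power_dvd:
  fixes g h :: "'a::{idom,ring_char_0} poly"
  assumes "2 \<le> num_terms h" "h ^ r dvd g" "g \<noteq> 0"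
  shows "r < num_terms g"
  using assms(2,3)
proof (induction r arbitrary: g)
  case 0
  then show ?case using num_terms_eq_0_iff[of g] by simp
next
  case (Suc r)
  obtain q where q: "g = h ^ Suc r * q" using Suc.prems(1) by (auto simp: dvd_def)
  obtain e where e: "low e g" "coeff g e \<noteq> 0" using low_exists[OF Suc.prems(2)] .
  define g1 where "g1 = euler g - of_nat e * g"
  have c1: "coeff g1 n = (of_nat n - of_nat e) * coeff g n" for n
    by (simp add: g1_def coeff_euler of_nat_poly algebra_simps)
  have "{i. coeff g1 i \<noteq> 0} = {i. coeff g i \<noteq> 0} - {e}" by (auto simp: c1)
  then have n1: "num_terms g1 = num_terms g - 1"
    using e(2) by (simp add: num_terms_def finite_coeffs card_Diff_singleton_if)
  \<comment> \<open>With two terms in \<open>g\<close>, one survives in \<open>g1\<close>, so that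
    the induction hypothesis meets a nonzero polynomial.\<close>
  have "2 \<le> num_terms g"
    using two_le_num_terms_mult[OF assms(1), of "h ^ r * q"] q Suc.prems(2) by (simp add: mult.assoc)
  then have "g1 \<noteq> 0" using n1 num_terms_eq_0_iff[of g1] by auto
  have "euler (h ^ Suc r) = h ^ r * euler h + h * euler (h ^ r)" by (simp add: euler_mult algebra_simps)
  then have "h ^ r dvd euler (h ^ Suc r)" unfolding euler_power by simp
  then have "h ^ r dvd euler g" unfolding q euler_mult[of "h ^ Suc r"]
    by (intro dvd_add dvd_mult2) simp_all
  moreover have "h ^ r dvd g" using Suc.prems(1) by (metis dvd_trans le_imp_power_dvd lessI less_imp_le)
  ultimately have "h ^ r dvd g1" by (simp add: g1_def)
  then have "r < num_terms g1" using Suc.IH \<open>g1 \<noteq> 0\<close> by blast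
  then show ?case using n1 by simp
qed

section \<open>Polynomials as lists of terms\<close>

definition poly_of :: "('a::comm_monoid_add \<times> nat) list \<Rightarrow> 'a poly" where
  "poly_of cs = (\<Sum>(c, e)\<leftarrow>cs. monom c e)"

lemma poly_of_Nil [simp]: "poly_of [] = 0"
  and poly_of_Cons: "poly_of (x # cs) = monom (fst x) (snd x) + poly_of cs"
  and poly_of_append: "poly_of (cs @ ds) = poly_of cs + poly_of ds"
  by (simp_all add: poly_of_def case_prod_beta)

text \<open>These are exactly the lists of the form \<open>lacunary g\<close>. Strictness of the
  order excludes repeated exponents, hence any merging of terms.\<close>

definition reduced :: "('a::zero \<times> nat) list \<Rightarrow> bool" where
  "reduced cs \<longleftrightarrow> sorted_wrt (<) (map snd cs) \<and> 0 \<notin> fst ` set cs"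

lemma coeff_poly_of:
  assumes "sorted_wrt (<) (map snd cs)"
  shows "(\<forall>(c, e)\<in>set cs. coeff (poly_of cs) e = c) \<and> (\<forall>n. n \<notin> snd ` set cs \<longrightarrow> coeff (poly_of cs) n = 0)"
  using assms
proof (induction cs)
  case (Cons x cs)
  then have "snd x \<notin> snd ` set cs" by (metis list.set_map list.simps(9) order_less_irrefl sorted_wrt.simps(2))
  with Cons show ?case by (force simp: poly_of_Cons)
qed simp

lemma lacunary_poly_of:
  assumes "reduced cs"
  shows "lacunary (poly_of cs) = cs" "num_terms (poly_of cs) = length cs"
proof -
  have s: "sorted_wrt (<) (map snd cs)" and nz: "0 \<notin> fst ` set cs" using assms by (auto simp: reduced_def)
  note c = coeff_poly_of[OF s]
  have supp: "{i. coeff (poly_of cs) i \<noteq> 0} = set (map snd cs)"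
  proof (intro equalityI subsetI)
    fix i assume "i \<in> set (map snd cs)"
    then obtain a where "(a, i) \<in> set cs" by force
    moreover from this have "a \<noteq> 0" using nz by force
    ultimately show "i \<in> {i. coeff (poly_of cs) i \<noteq> 0}" using c by auto
  qed (use c in force)
  have sd: "sorted (map snd cs)" "distinct (map snd cs)" using s by (simp_all add: strict_sorted_iff)
  have "sorted_list_of_set (set (map snd cs)) = map snd cs"
    using sd by (simp only: sorted_list_of_set.idem_if_sorted_distinct)
  then have "lacunary (poly_of cs) = map (\<lambda>x. (coeff (poly_of cs) (snd x), snd x)) cs"
    by (simp add: lacunary_def supp[simplified] o_def)
  also have "\<dots> = cs" using c by (intro map_idI) (auto split: prod.splits)
  finally show "lacunary (poly_of cs) = cs" .
  show "num_terms (poly_of cs) = length cs"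
    unfolding num_terms_def supp using distinct_card[OF sd(2)] by simp
qed

lemma set_lacunary: "set (lacunary g) = {(coeff g e, e) |e. coeff g e \<noteq> 0}"
  by (auto simp: lacunary_def finite_coeffs)

lemma length_lacunary: "length (lacunary g) = num_terms g"
  by (simp add: lacunary_def num_terms_def finite_coeffs)

lemma reduced_lacunary: "reduced (lacunary g)"
  using finite_coeffs[of g] by (auto simp: reduced_def set_lacunary lacunary_def o_def)

lemma poly_of_lacunary: "poly_of (lacunary g) = g"
proof (rule poly_eqI)
  fix n
  note c = coeff_poly_of[of "lacunary g"]
  have s: "sorted_wrt (<) (map snd (lacunary g))" using reduced_lacunary[of g] by (simp add: reduced_def)
  show "coeff (poly_of (lacunary g)) n = coeff g n"
  proof (cases "coeff g n = 0")
    case True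
    then have "n \<notin> snd ` set (lacunary g)" by (auto simp: set_lacunary)
    with True c[OF s] show ?thesis by simp
  next
    case False
    then have "(coeff g n, n) \<in> set (lacunary g)" by (auto simp: set_lacunary)
    with c[OF s] show ?thesis by auto
  qed
qed

lemma low_poly_of:
  assumes "reduced (x # cs)"
  shows "low (snd x) (poly_of (x # cs))" "coeff (poly_of (x # cs)) (snd x) = fst x" "fst x \<noteq> 0"
proof -
  have s: "sorted_wrt (<) (map snd (x # cs))" and nz: "0 \<notin> fst ` set (x # cs)"
    using assms by (auto simp: reduced_def)
  note c = coeff_poly_of[OF s]
  show "coeff (poly_of (x # cs)) (snd x) = fst x" using c by (auto split: prod.splits)
  show "fst x \<noteq> 0" using nz by auto
  have "n \<notin> snd ` set (x # cs)" if "n < snd x" for n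
    using s that by (auto dest: order.strict_trans)
  then show "low (snd x) (poly_of (x # cs))" unfolding low_def using c by blast
qed

subsection \<open>Programs with bounded running time\<close>

definition small :: "nat \<Rightarrow> int \<Rightarrow> bool" where
  "small B x \<longleftrightarrow> \<bar>x\<bar> < 2 ^ B"

lemma bits_le_if_small: "small B x \<Longrightarrow> bits x \<le> Suc B"
proof -
  assume "small B x"
  then have "nat \<bar>x\<bar> < 2 ^ B" by (simp add: small_def nat_less_iff)
  then have "floorlog 2 (nat \<bar>x\<bar>) \<le> B" by (simp add: floorlog_leI)
  then show ?thesis by (simp add: bits_def)
qed

text \<open>Time is counted in units of \<open>(B + 2)\<^sup>2\<close>, which dominates the cost of one operation on \<open>small\<close> operands.\<close>

definition runs :: "nat \<Rightarrow> com \<Rightarrow> nat \<Rightarrow> (state \<Rightarrow> bool) \<Rightarrow> state \<Rightarrow> bool" where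
  "runs B c m Q s \<longleftrightarrow> (\<exists>n s'. exec c s n s' \<and> n \<le> (B + 2)\<^sup>2 * m \<and> Q s')"

lemma runs_mono:
  assumes "runs B c m Q s" "m \<le> m'" "\<And>s'. Q s' \<Longrightarrow> Q' s'"
  shows "runs B c m' Q' s"
proof -
  obtain n s' where "exec c s n s'" "n \<le> (B + 2)\<^sup>2 * m" "Q s'" using assms(1) unfolding runs_def by blast
  moreover have "(B + 2)\<^sup>2 * m \<le> (B + 2)\<^sup>2 * m'" using assms(2) by simp
  ultimately show ?thesis using assms(3) unfolding runs_def by (meson le_trans)
qed

lemma bits_bounds:
  assumes "small B x"
  shows "bits x \<le> (B + 2)\<^sup>2" "small B y \<Longrightarrow> bits x + bits y \<le> (B + 2)\<^sup>2"
    "small B y \<Longrightarrow> bits x * bits y \<le> (B + 2)\<^sup>2"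
proof -
  have x: "bits x \<le> B + 1" using bits_le_if_small[OF assms] by simp
  have sq: "(B + 2)\<^sup>2 = B * B + 4 * B + 4" by (simp add: power2_eq_square algebra_simps)
  show "bits x \<le> (B + 2)\<^sup>2" using x sq by linarith
  assume "small B y"
  then have y: "bits y \<le> B + 1" using bits_le_if_small[of B y] by simp
  show "bits x + bits y \<le> (B + 2)\<^sup>2" using x y sq by linarith
  have "bits x * bits y \<le> (B + 1) * (B + 1)" by (rule mult_mono[OF x y]) auto
  then show "bits x * bits y \<le> (B + 2)\<^sup>2" using sq by simp
qed

lemma op_cost_le: "small B x \<Longrightarrow> small B y \<Longrightarrow> op_cost b x y \<le> (B + 2)\<^sup>2"
  using bits_bounds(2,3)[of B x y] by (cases b) auto

text \<open>One small operand suffices, because a comparison stops at the end of the shorter number.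
  This is what allows the unbounded input \<open>r\<close> to be tested against
  \<open>t\<close>.\<close>

lemma less_cost_le: "small B x \<or> small B y \<Longrightarrow> less_cost x y \<le> (B + 2)\<^sup>2"
  unfolding less_cost_def using bits_bounds(1) by (auto intro: min.coboundedI1 min.coboundedI2)

lemma runs_Seq:
  assumes "runs B c1 m (\<lambda>s'. runs B c2 n Q s') s"
  shows "runs B (Seq c1 c2) (m + n) Q s"
proof -
  obtain a s1 b s2 where "exec c1 s a s1" "a \<le> (B + 2)\<^sup>2 * m" "exec c2 s1 b s2" "b \<le> (B + 2)\<^sup>2 * n" "Q s2"
    using assms unfolding runs_def by blast
  then show ?thesis unfolding runs_def
    by (intro exI[of _ "a + b"] exI[of _ s2]) (auto intro: exec.Seq simp: distrib_left)
qed

lemma runs_IfLess: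
  assumes "small B (regs s x) \<or> small B (regs s y)"
    and "regs s x < regs s y \<Longrightarrow> runs B c1 m Q s"
    and "\<not> regs s x < regs s y \<Longrightarrow> runs B c2 m Q s"
  shows "runs B (IfLess x y c1 c2) (Suc m) Q s"
proof -
  note c = less_cost_le[OF assms(1)]
  show ?thesis
  proof (cases "regs s x < regs s y")
    case True
    then obtain n s' where "exec c1 s n s'" "n \<le> (B + 2)\<^sup>2 * m" "Q s'"
      using assms(2) unfolding runs_def by blast
    with True c show ?thesis unfolding runs_def
      by (intro exI[of _ "less_cost (regs s x) (regs s y) + n"] exI[of _ s']) (auto intro: exec.IfTrue)
  next
    case False
    then obtain n s' where "exec c2 s n s'" "n \<le> (B + 2)\<^sup>2 * m" "Q s'"
      using assms(3) unfolding runs_def by blast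
    with False c show ?thesis unfolding runs_def
      by (intro exI[of _ "less_cost (regs s x) (regs s y) + n"] exI[of _ s']) (auto intro: exec.IfFalse)
  qed
qed

text \<open>The variant bounds the number of rounds; each round pays its body and one comparison,
  and the final \<open>+ 1\<close> is the comparison that leaves the loop.\<close>

lemma runs_WhileLess:
  assumes "I s" "V s \<le> v"
    and small: "\<And>s. I s \<Longrightarrow> small B (regs s x) \<or> small B (regs s y)"
    and body: "\<And>s. I s \<Longrightarrow> regs s x < regs s y \<Longrightarrow> runs B c m (\<lambda>s'. I s' \<and> V s' < V s) s"
    and exit: "\<And>s. I s \<Longrightarrow> \<not> regs s x < regs s y \<Longrightarrow> Q s"
  shows "runs B (WhileLess x y c) (v * (m + 1) + 1) Q s"
  using assms(1,2)
proof (induction v arbitrary: s rule: less_induct)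
  case (less v)
  note c = less_cost_le[OF small[OF less.prems(1)]]
  show ?case
  proof (cases "regs s x < regs s y")
    case True
    obtain a s1 where 1: "exec c s a s1" "a \<le> (B + 2)\<^sup>2 * m" "I s1" "V s1 < V s"
      using body[OF less.prems(1) True] unfolding runs_def by blast
    have v: "v - 1 < v" "V s1 \<le> v - 1" using 1(4) less.prems(2) by auto
    obtain b s2 where 2: "exec (WhileLess x y c) s1 b s2" "b \<le> (B + 2)\<^sup>2 * ((v - 1) * (m + 1) + 1)" "Q s2"
      using less.IH[OF v(1) 1(3) v(2)] unfolding runs_def by blast
    let ?l = "less_cost (regs s x) (regs s y)"
    have "v * (m + 1) + 1 = (v - 1) * (m + 1) + 1 + m + 1" using v(1) by (cases v) auto
    then have "?l + a + b \<le> (B + 2)\<^sup>2 * (v * (m + 1) + 1)"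
      using c 1(2) 2(2) by (simp only: distrib_left mult_1_right)
    with exec.WhileTrue[where s = s, OF True 1(1) 2(1)] 2(3) show ?thesis unfolding runs_def by blast
  next
    case False
    have "(B + 2)\<^sup>2 \<le> (B + 2)\<^sup>2 * (v * (m + 1) + 1)" by simp
    with c have "less_cost (regs s x) (regs s y) \<le> (B + 2)\<^sup>2 * (v * (m + 1) + 1)" by (rule le_trans)
    with exec.WhileFalse[where s = s, OF False] exit[OF less.prems(1) False] show ?thesis
      unfolding runs_def by blast
  qed
qed

fun loop_free :: "com \<Rightarrow> bool" where
  "loop_free (Seq c1 c2) \<longleftrightarrow> loop_free c1 \<and> loop_free c2"
| "loop_free (IfLess x y c1 c2) \<longleftrightarrow> loop_free c1 \<and> loop_free c2"
| "loop_free (WhileLess x y c) \<longleftrightarrow> False"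
| "loop_free c \<longleftrightarrow> True"

fun steps :: "com \<Rightarrow> nat" where
  "steps (Seq c1 c2) = steps c1 + steps c2"
| "steps (IfLess x y c1 c2) = Suc (max (steps c1) (steps c2))"
| "steps c = 1"

text \<open>A weakest precondition that also demands small operands, so that simplification executes
  straight-line code and collects the size conditions together. A result is constrained only once it
  is read again. Loops are excluded; they are treated by invariants.\<close>

fun wp :: "nat \<Rightarrow> com \<Rightarrow> (state \<Rightarrow> bool) \<Rightarrow> state \<Rightarrow> bool" where
  "wp B Skip Q s \<longleftrightarrow> Q s"
| "wp B (Const x v) Q s \<longleftrightarrow> small B v \<and> Q (s\<lparr>regs := (regs s)(x := v)\<rparr>)"
| "wp B (Op b x y z) Q s \<longleftrightarrow> small B (regs s y) \<and> small B (regs s z) \<and>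
     Q (s\<lparr>regs := (regs s)(x := op_val b (regs s y) (regs s z))\<rparr>)"
| "wp B (Load x a i) Q s \<longleftrightarrow> small B (regs s i) \<and> small B (arrs s a (regs s i)) \<and>
     Q (s\<lparr>regs := (regs s)(x := arrs s a (regs s i))\<rparr>)"
| "wp B (Store a i x) Q s \<longleftrightarrow> small B (regs s i) \<and> small B (regs s x) \<and>
     Q (s\<lparr>arrs := (arrs s)(a := (arrs s a)(regs s i := regs s x))\<rparr>)"
| "wp B (Seq c1 c2) Q s \<longleftrightarrow> wp B c1 (\<lambda>s'. wp B c2 Q s') s"
| "wp B (IfLess x y c1 c2) Q s \<longleftrightarrow> (small B (regs s x) \<or> small B (regs s y)) \<and>
     (if regs s x < regs s y then wp B c1 Q s else wp B c2 Q s)"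
| "wp B (WhileLess x y c) Q s \<longleftrightarrow> False"

lemma runs_wp: "wp B c Q s \<Longrightarrow> runs B c (steps c) Q s"
proof (induction c arbitrary: Q s)
  case Skip
  then show ?case unfolding runs_def
    by (intro exI[of _ 1] exI[of _ s]) (use exec.Skip[of s] in auto)
next
  case (Const x v)
  then show ?case unfolding runs_def using exec.Const[of x v s] bits_bounds(1)[of B v] by auto
next
  case (Op b x y z)
  then show ?case unfolding runs_def using exec.Op[of b x y z s] op_cost_le[of B _ _ b] by fastforce
next
  case (Load x a i)
  then show ?case unfolding runs_def using exec.Load[of x a i s] bits_bounds(2)[of B] by fastforce
next
  case (Store a i x)
  then show ?case unfolding runs_def using exec.Store[of a i x s] bits_bounds(2)[of B] by fastforce
next
  case (Seq c1 c2)
  then have "runs B c1 (steps c1) (\<lambda>s'. wp B c2 Q s') s" by simp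
  then have "runs B c1 (steps c1) (\<lambda>s'. runs B c2 (steps c2) Q s') s"
    by (rule runs_mono) (use Seq.IH in auto)
  then show ?case by (simp add: runs_Seq)
next
  case (IfLess x y c1 c2)
  have "runs B c1 (max (steps c1) (steps c2)) Q s" if "wp B c1 Q s"
    by (rule runs_mono[OF IfLess.IH(1)[OF that]]) auto
  moreover have "runs B c2 (max (steps c1) (steps c2)) Q s" if "wp B c2 Q s"
    by (rule runs_mono[OF IfLess.IH(2)[OF that]]) auto
  ultimately show ?case using IfLess.prems by (auto intro!: runs_IfLess split: if_splits)
next
  case WhileLess then show ?case by simp
qed

lemma runs_count:
  assumes "I 0 s" "small B (int N)"
    and body: "\<And>k s. k < N \<Longrightarrow> I k s \<Longrightarrow> runs B c m (I (Suc k)) s"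
    and counter: "\<And>k s. k \<le> N \<Longrightarrow> I k s \<Longrightarrow> regs s i = int k \<and> regs s y = int N"
    and exit: "\<And>s. I N s \<Longrightarrow> Q s"
  shows "runs B (WhileLess i y c) (N * (m + 1) + 1) Q s"
proof (rule runs_WhileLess[where I = "\<lambda>s. \<exists>k\<le>N. I k s" and V = "\<lambda>s. nat (regs s y - regs s i)"])
  show "\<exists>k\<le>N. I k s" using assms(1) by blast
  show "nat (regs s y - regs s i) \<le> N" using counter[OF _ assms(1)] by simp
next
  fix s assume "\<exists>k\<le>N. I k s"
  then show "small B (regs s i) \<or> small B (regs s y)" using counter assms(2) by metis
next
  fix s assume "\<exists>k\<le>N. I k s" "regs s i < regs s y"
  then obtain k where k: "k \<le> N" "I k s" by blast
  then have kN: "k < N" using counter[OF k] \<open>regs s i < regs s y\<close> by simp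
  show "runs B c m (\<lambda>s'. (\<exists>k\<le>N. I k s') \<and> nat (regs s' y - regs s' i) < nat (regs s y - regs s i)) s"
  proof (rule runs_mono[OF body[OF kN k(2)] order_refl])
    fix s' assume s': "I (Suc k) s'"
    show "(\<exists>k\<le>N. I k s') \<and> nat (regs s' y - regs s' i) < nat (regs s y - regs s i)"
      using s' kN counter[OF _ s'] counter[OF k] by (auto intro: exI[of _ "Suc k"])
  qed
next
  fix s assume "\<exists>k\<le>N. I k s" "\<not> regs s i < regs s y"
  then obtain k where k: "k \<le> N" "I k s" by blast
  then have "k = N" using counter[OF k] \<open>\<not> regs s i < regs s y\<close> by simp
  then show "Q s" using k exit by simp
qed

subsection \<open>Computing the terms of the root\<close>

fun block :: "com list \<Rightarrow> com" where
  "block [] = Skip"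
| "block [c] = c"
| "block (c # cs) = Seq c (block cs)"

abbreviation (input) "rT \<equiv> 0 :: reg"
abbreviation (input) "rMU \<equiv> 2 :: reg"
abbreviation (input) "rOUT \<equiv> 3 :: reg"
abbreviation (input) "rR \<equiv> 4 :: reg"
abbreviation (input) "rZERO \<equiv> 5 :: reg"
abbreviation (input) "rONE \<equiv> 6 :: reg"
abbreviation (input) "rK \<equiv> 7 :: reg"
abbreviation (input) "rM \<equiv> 8 :: reg"
abbreviation (input) "rGO \<equiv> 9 :: reg"
abbreviation (input) "rC0 \<equiv> 10 :: reg"
abbreviation (input) "rE0 \<equiv> 11 :: reg"
abbreviation (input) "rB \<equiv> 12 :: reg"
abbreviation (input) "rD \<equiv> 13 :: reg"
abbreviation (input) "rI \<equiv> 14 :: reg"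
abbreviation (input) "rX \<equiv> 15 :: reg"
abbreviation (input) "rY \<equiv> 16 :: reg"
abbreviation (input) "rW \<equiv> 17 :: reg"
abbreviation (input) "rFOUND \<equiv> 20 :: reg"
abbreviation (input) "rP \<equiv> 21 :: reg"
abbreviation (input) "rU \<equiv> 22 :: reg"
abbreviation (input) "rS \<equiv> 23 :: reg"
abbreviation (input) "rQ \<equiv> 24 :: reg"
abbreviation (input) "rV \<equiv> 25 :: reg"
abbreviation (input) "rSQ \<equiv> 26 :: reg"
abbreviation (input) "rBEST \<equiv> 27 :: reg"
abbreviation (input) "rBESTC \<equiv> 28 :: reg"
abbreviation (input) "rN \<equiv> 30 :: reg"
abbreviation (input) "rLO \<equiv> 31 :: reg"
abbreviation (input) "rHI \<equiv> 32 :: reg"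
abbreviation (input) "rGAP \<equiv> 33 :: reg"
abbreviation (input) "rMID \<equiv> 34 :: reg"
abbreviation (input) "rPOW \<equiv> 35 :: reg"
abbreviation (input) "rLOP \<equiv> 36 :: reg"
abbreviation (input) "rTWO \<equiv> 37 :: reg"

text \<open>The arrays \<open>aU\<close> and \<open>aV\<close> hold exponents and coefficients of the residual, unsorted and with
  repeated exponents; register \<open>rM\<close> is their length.\<close>

abbreviation (input) "aC \<equiv> 0 :: arr"
abbreviation (input) "aE \<equiv> Suc 0 :: arr"
abbreviation (input) "aHC \<equiv> 2 :: arr"
abbreviation (input) "aHE \<equiv> 3 :: arr"
abbreviation (input) "aU \<equiv> 4 :: arr"
abbreviation (input) "aV \<equiv> 5 :: arr"

text \<open>One round treats one term of \<open>f\<close>: by \<open>resid_monom_monom\<close> a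
  term \<open>c * x ^ e\<close> of \<open>f\<close> and the new monomial \<open>b * x ^ d\<close>
  contribute \<open>c * b * (r * d - e)\<close> at the exponent \<open>e + d\<close>. Additivity of
  the residual makes appending enough.\<close>

definition append_body :: com where
  "append_body = block [
     Load rX aE rI, Op Add rW rX rD, Store aU rM rW,
     Op Mul rY rR rD, Op Sub rY rY rX, Op Mul rY rB rY, Load rX aC rI, Op Mul rY rX rY, Store aV rM rY,
     Op Add rM rM rONE, Op Add rI rI rONE]"

definition append_init :: com where
  "append_init = block [Store aHC rK rB, Store aHE rK rD, Op Add rK rK rONE, Const rI 0]"

definition append_term :: com where
  "append_term = Seq append_init (Seq (WhileLess rI rT append_body) (Const rGO 1))"

text \<open>The machine only compares by \<open><\<close>, so equality of exponents is the failure
  of both strict comparisons. As exponents may repeat in the list, only the sum of all matching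
  entries is a coefficient.\<close>

definition sum_body :: com where
  "sum_body = block [
     Load rV aU rQ,
     IfLess rV rU Skip (IfLess rU rV Skip (Seq (Load rV aV rQ) (Op Add rS rS rV))),
     Op Add rQ rQ rONE]"

definition find_update :: com where
  "find_update = block [Op Add rBEST rU rZERO, Op Add rBESTC rS rZERO, Const rFOUND 1]"

definition find_pre :: com where
  "find_pre = block [Load rU aU rP, Const rS 0, Const rQ 0]"

text \<open>Squaring turns the test for a nonzero sum into a single comparison with 0. The flag
  \<open>rFOUND\<close> replaces a sentinel value for the minimum.\<close>

definition find_post :: com where
  "find_post = block [
     Op Mul rSQ rS rS,
     IfLess rZERO rSQ (IfLess rFOUND rONE find_update (IfLess rU rBEST find_update Skip)) Skip,
     Op Add rP rP rONE]"

definition find_lowest :: com where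
  "find_lowest = Seq (Seq (Const rFOUND 0) (Const rP 0))
     (WhileLess rP rM (Seq find_pre (Seq (WhileLess rQ rM sum_body) find_post)))"

text \<open>Solves the equation of \<open>resid_next_term\<close>, where \<open>r * d0 = e0\<close>:
  the exponent is found by subtracting \<open>e0\<close>, the coefficient by a division. The square
  of the remainder ends up in \<open>rW\<close> and is positive exactly when the division is not
  exact.\<close>

definition next_init :: com where
  "next_init = block [
     Op Sub rD rBEST rE0, Op Mul rY rR rD, Op Sub rY rY rE0, Op Mul rY rY rC0,
     Op Sub rX rZERO rBESTC, Op Div rB rX rY, Op Mul rW rB rY, Op Sub rW rW rX, Op Mul rW rW rW]"

text \<open>Refutation only clears the loop flag: the output register holds -1 from the start and is
  overwritten only when the residual vanishes.\<close>

definition next_term :: com where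
  "next_term = IfLess rZERO rFOUND
     (IfLess rK rMU
       (Seq next_init (IfLess rZERO rW (Const rGO 0) append_term))
       (Const rGO 0))
     (Seq (Op Add rOUT rK rZERO) (Const rGO 0))"

definition root_loop :: com where
  "root_loop = Seq (Seq (Const rK 0) (Const rM 0)) (Seq append_term
     (WhileLess rZERO rGO (Seq find_lowest next_term)))"

section \<open>Size bounds and appending a term\<close>

lemma abs_div_le: "\<bar>x div y\<bar> \<le> \<bar>x :: int\<bar>"
proof (cases "y = 0")
  case False
  have "\<bar>x div y\<bar> * 1 \<le> \<bar>x\<bar>"
  proof (cases "0 < y")
    case True
    then show ?thesis
      by (smt (verit, best) div_pos_pos_trivial zdiv_mono1 div_by_1 zdiv_mono2 zdiv_mono2_neg pos_imp_zdiv_neg_iff pos_imp_zdiv_nonneg_iff)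
  next
    case neg: False
    then have "0 < - y" using False by simp
    moreover have "x div y = (- x) div (- y)" by simp
    ultimately show ?thesis
      by (smt (verit, best) div_pos_pos_trivial zdiv_mono1 div_by_1 zdiv_mono2 zdiv_mono2_neg pos_imp_zdiv_neg_iff pos_imp_zdiv_nonneg_iff)
  qed
  then show ?thesis by simp
qed simp

text \<open>\<open>A\<close> bounds all parts of the input at once, so that every size becomes a
  power of \<open>A\<close>; \<open>L\<close> bounds the number of bisection rounds. In the exponent
  defining \<open>B\<close>, \<open>20 * \<mu>\<close> pays for the squares used as zero tests
  (entries grow by 10 per term), \<open>length cs\<close> for the integer powers
  \<open>x ^ r\<close> with \<open>r < length cs\<close>, and 40 is slack.\<close>

locale algorithm =
  fixes cs :: "(int \<times> nat) list" and r \<mu> B L :: nat and A :: int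
  assumes A: "2 \<le> A" and A_L: "A < 2 ^ L"
    and length_le: "int (length cs) \<le> A" and \<mu>_le: "int \<mu> + 2 \<le> A"
    and cs_le: "\<And>c e. (c, e) \<in> set cs \<Longrightarrow> \<bar>c\<bar> \<le> A \<and> int e \<le> A"
    and reduced: "reduced cs" and length_ge: "2 \<le> length cs"
    and r: "0 < r" "r < length cs" and \<mu>: "0 < \<mu>"
    and B: "A ^ (20 * \<mu> + length cs + 40) < 2 ^ B"
begin

abbreviation "t \<equiv> length cs"
abbreviation "f \<equiv> poly_of cs"
abbreviation "c0 \<equiv> fst (cs ! 0)"
abbreviation "e0 \<equiv> snd (cs ! 0)"

lemma power_A_mono: "i \<le> j \<Longrightarrow> A ^ i \<le> A ^ j"
  using A by (simp add: power_increasing)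

lemma abs_mult_le_power:
  assumes "\<bar>x\<bar> \<le> A ^ i" "\<bar>y\<bar> \<le> A ^ j" "i + j \<le> k"
  shows "\<bar>x * y\<bar> \<le> A ^ k"
proof -
  have "\<bar>x * y\<bar> \<le> A ^ i * A ^ j"
    unfolding abs_mult by (rule mult_mono[OF assms(1,2)]) (use A in auto)
  also have "\<dots> \<le> A ^ k" using power_A_mono[OF assms(3)] by (simp only: power_add)
  finally show ?thesis .
qed

lemma small_if_le_power: "\<bar>x\<bar> \<le> A ^ i \<Longrightarrow> i \<le> 20 * \<mu> + t + 40 \<Longrightarrow> small B x"
  using power_A_mono[of i "20 * \<mu> + t + 40"] B unfolding small_def by linarith

lemma small_if_le: "\<bar>x\<bar> \<le> A \<Longrightarrow> small B x"
  using small_if_le_power[of x 1] by simp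

lemma small_numeral [simp]: "small B 0" "small B 1" "small B 2"
  using A by (auto intro!: small_if_le)

lemma small_params [simp]: "small B (int t)" "small B (int r)" "small B (int \<mu>)"
  using A length_le \<mu>_le r by (auto intro!: small_if_le)

lemma cs_nth_le: "i < t \<Longrightarrow> \<bar>fst (cs ! i)\<bar> \<le> A \<and> int (snd (cs ! i)) \<le> A"
  using cs_le[of "fst (cs ! i)" "snd (cs ! i)"] by simp

lemma small_index: "i < t \<Longrightarrow> small B (int i)"
  using length_le by (auto intro!: small_if_le)

lemma small_cs [simp]: "i < t \<Longrightarrow> small B (fst (cs ! i))" "i < t \<Longrightarrow> small B (int (snd (cs ! i)))"
  using cs_nth_le by (auto intro!: small_if_le)

definition base :: "state \<Rightarrow> bool" where
  "base s \<longleftrightarrow> regs s rT = int t \<and> regs s rMU = int \<mu> \<and> regs s rR = int r \<and> regs s rZERO = 0 \<and>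
     regs s rONE = 1 \<and> regs s rC0 = c0 \<and> regs s rE0 = int e0 \<and>
     (\<forall>i<t. arrs s aC (int i) = fst (cs ! i) \<and> arrs s aE (int i) = int (snd (cs ! i))) \<and>
     regs s rOUT = -1"

definition stored :: "(int \<times> nat) list \<Rightarrow> state \<Rightarrow> bool" where
  "stored hs s \<longleftrightarrow>
     (\<forall>i<length hs. arrs s aHC (int i) = fst (hs ! i) \<and> arrs s aHE (int i) = int (snd (hs ! i)))"

definition rep :: "(int \<Rightarrow> int) \<Rightarrow> (int \<Rightarrow> int) \<Rightarrow> nat \<Rightarrow> int poly \<Rightarrow> int \<Rightarrow> int \<Rightarrow> bool" where
  "rep U V m p X Z \<longleftrightarrow> (\<forall>q<m. 0 \<le> U (int q) \<and> U (int q) \<le> X \<and> \<bar>V (int q)\<bar> \<le> Z) \<and>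
     (\<forall>n. coeff p n = (\<Sum>q<m. if U (int q) = int n then V (int q) else 0))"

lemma rep_0: "rep U V 0 0 X Z"
  by (simp add: rep_def)

lemma rep_mono: "rep U V m p X Z \<Longrightarrow> X \<le> X' \<Longrightarrow> Z \<le> Z' \<Longrightarrow> rep U V m p X' Z'"
  by (force simp: rep_def)

lemma rep_Suc:
  assumes "rep U V m p X Z" "int n \<le> X" "\<bar>v\<bar> \<le> Z"
  shows "rep (U(int m := int n)) (V(int m := v)) (Suc m) (p + monom v n) X Z"
  using assms by (auto simp: rep_def less_Suc_eq intro!: sum.cong)

text \<open>Where 10 comes from: adding up entries of equal exponent costs a factor
  \<open>A ^ 2\<close>, the division costs nothing, and the new entry
  \<open>c * b * (r * d - e)\<close> gains \<open>A * A ^ 3\<close>; the rest is slack. Exponents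
  grow only linearly: the next one is at most an exponent in the list, and adding an exponent of
  \<open>f\<close> costs one more \<open>A\<close>.\<close>

definition inv :: "(int \<times> nat) list \<Rightarrow> state \<Rightarrow> bool" where
  "inv hs s \<longleftrightarrow> base s \<and> stored hs s \<and> regs s rK = int (length hs) \<and>
     regs s rM = int (length hs * t) \<and>
     rep (arrs s aU) (arrs s aV) (length hs * t) (resid f r (poly_of hs))
       (A * (int (length hs) + 1)) (A ^ (10 * length hs))"

lemma stored_snoc:
  assumes "stored hs s"
  shows "stored (hs @ [(b, d)]) (s\<lparr>arrs := (arrs s)(aHC := (arrs s aHC)(int (length hs) := b),
    aHE := (arrs s aHE)(int (length hs) := int d))\<rparr>)"
  using assms by (auto simp: stored_def less_Suc_eq nth_append)

lemma append_term_runs: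
  assumes s: "inv hs s" "regs s rB = b" "regs s rD = int d"
    and le: "int d \<le> A * (int (length hs) + 1)" "\<bar>b\<bar> \<le> A ^ (10 * length hs + 3)" "length hs \<le> \<mu>"
  shows "runs B append_term (t * 12 + 6) (\<lambda>s'. inv (hs @ [(b, d)]) s' \<and> regs s' rGO = 1) s"
proof -
  let ?k = "length hs"
  let ?m = "?k * t"
  \<comment> \<open>\<open>X\<close> and \<open>Z\<close> are already the bounds that
    \<open>inv\<close> demands after the append, for length \<open>?k + 1\<close>.\<close>
  define X where "X = A * (int ?k + 2)"
  define Z where "Z = A ^ (10 * (?k + 1))"
  have kA: "int ?k + 2 \<le> A" using \<mu>_le le(3) by simp
  have A2: "A * (int ?k + 2) \<le> A ^ 2" using kA A by (simp add: power2_eq_square)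
  have d2: "int d \<le> A ^ 2" using le(1) A2 A by (simp add: distrib_left)
  have m2: "int (Suc ?k * t) \<le> A ^ 2"
    using mult_mono[of "int ?k + 1" A "int t" A] kA length_le A by (simp add: power2_eq_square algebra_simps)
  \<comment> \<open>Additivity of \<open>resid\<close> in its first argument lets the invariant
    speak of the processed prefix of \<open>f\<close>.\<close>
  define I where "I i s' \<longleftrightarrow> base s' \<and> stored (hs @ [(b, d)]) s' \<and> regs s' rK = int ?k + 1 \<and>
    regs s' rB = b \<and> regs s' rD = int d \<and> regs s' rI = int i \<and> regs s' rM = int (?m + i) \<and>
    rep (arrs s' aU) (arrs s' aV) (?m + i)
      (resid f r (poly_of hs) + resid (poly_of (take i cs)) r (monom b d)) X Z" for i s'
  have sb: "small B b" by (rule small_if_le_power[OF le(2)]) (use le(3) in simp)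
  have sd: "small B (int d)" by (rule small_if_le_power[of _ 2]) (use d2 in auto)
  have sk: "small B (int ?k)" by (rule small_if_le) (use kA in auto)
  have init: "runs B append_init 4 (I 0) s"
  proof -
    have "rep (arrs s aU) (arrs s aV) ?m (resid f r (poly_of hs)) X Z"
      using s(1) unfolding inv_def X_def Z_def
      by (elim conjE rep_mono) (use A in \<open>auto intro: power_A_mono simp: distrib_left\<close>)
    moreover have "stored (hs @ [(b, d)]) (s\<lparr>arrs := (arrs s)(aHC := (arrs s aHC)(int ?k := b),
        aHE := (arrs s aHE)(int ?k := int d))\<rparr>)"
      using s(1) by (intro stored_snoc) (simp add: inv_def)
    ultimately have "wp B append_init (I 0) s"
      using s sb sd sk unfolding append_init_def
      by (simp add: I_def inv_def base_def stored_def)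
    from runs_wp[OF this] show ?thesis by (rule runs_mono) (simp_all add: append_init_def)
  qed
  have body: "runs B append_body 11 (I (Suc i)) s'" if i: "i < t" and s': "I i s'" for i s'
  proof -
    let ?c = "fst (cs ! i)" and ?e = "snd (cs ! i)"
    let ?y1 = "int r * int d" and ?y2 = "int r * int d - int ?e"
    note ce = cs_nth_le[OF i]
    have "?y1 \<le> A * A ^ 2" by (rule mult_mono) (use r length_le d2 A in auto)
    then have y1: "?y1 \<le> A ^ 3" by (simp add: power3_eq_cube power2_eq_square)
    have "A \<le> A ^ 3" using power_A_mono[of 1 3] by simp
    moreover have "0 \<le> ?y1" "0 \<le> int ?e" by simp_all
    ultimately have y2: "\<bar>?y2\<bar> \<le> A ^ 3" using y1 conjunct2[OF ce] by linarith
    have y3: "\<bar>b * ?y2\<bar> \<le> A ^ (10 * ?k + 6)" by (rule abs_mult_le_power[OF le(2) y2]) simp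
    have y4: "\<bar>?c * (b * ?y2)\<bar> \<le> A ^ (10 * ?k + 7)"
      by (rule abs_mult_le_power[OF _ y3, of _ 1]) (use ce in auto)
    have yZ: "\<bar>?c * (b * ?y2)\<bar> \<le> Z" using y4 power_A_mono[of "10 * ?k + 7" "10 * (?k + 1)"] by (simp add: Z_def)
    have eX: "int (?e + d) \<le> X" using ce le(1) by (simp add: X_def distrib_left)
    have sm: "small B ?y1" "small B ?y2" "small B (b * ?y2)" "small B (?c * (b * ?y2))"
      using y1 y2 y3 y4 le(3) by (auto intro!: small_if_le_power)
    have se: "small B (int ?e + int d)"
      by (rule small_if_le_power[of _ 2]) (use eX A2 in \<open>auto simp: X_def\<close>)
    have "int (?m + i) \<le> int (Suc ?k * t)" using i by simp
    then have smi: "small B (int (?m + i))"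
      using m2 by (intro small_if_le_power[of _ 2]) linarith+
    have si: "small B (int i)" using i by (rule small_index)
    have mon: "resid (poly_of (take (Suc i) cs)) r (monom b d)
        = resid (poly_of (take i cs)) r (monom b d) + monom (?c * (b * ?y2)) (?e + d)"
      using i by (simp add: take_Suc_conv_app_nth poly_of_append poly_of_Cons resid_add_left resid_monom_monom mult.assoc)
    have "rep ((arrs s' aU)(int (?m + i) := int (?e + d))) ((arrs s' aV)(int (?m + i) := ?c * (b * ?y2)))
       (Suc (?m + i)) (resid f r (poly_of hs) + resid (poly_of (take i cs)) r (monom b d) +
         monom (?c * (b * ?y2)) (?e + d)) X Z"
      using s' unfolding I_def by (intro rep_Suc eX yZ) simp
    then have rep': "rep ((arrs s' aU)(int ?m + int i := int ?e + int d))
        ((arrs s' aV)(int ?m + int i := ?c * (b * ?y2)))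
       (Suc (?m + i)) (resid f r (poly_of hs) + resid (poly_of (take (Suc i) cs)) r (monom b d)) X Z"
      unfolding mon by (simp only: add.assoc of_nat_add)
    have "wp B append_body (I (Suc i)) s'"
      using s' i sb sd sm se si smi rep' unfolding append_body_def
      by (simp add: I_def base_def stored_def add_ac)
    from runs_wp[OF this] show ?thesis by (rule runs_mono) (simp_all add: append_body_def)
  qed
  have loop: "runs B (WhileLess rI rT append_body) (t * (11 + 1) + 1) (\<lambda>s'. I t s') s'" if "I 0 s'" for s'
    by (rule runs_count[where I = I]) (use that body in \<open>auto simp: I_def base_def\<close>)
  have fin: "runs B (Const rGO 1) 1 (\<lambda>s'. inv (hs @ [(b, d)]) s' \<and> regs s' rGO = 1) s'" if "I t s'" for s'
  proof -
    have "wp B (Const rGO 1) (\<lambda>s'. inv (hs @ [(b, d)]) s' \<and> regs s' rGO = 1) s'"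
      using that by (simp add: I_def inv_def base_def stored_def X_def Z_def poly_of_append poly_of_Cons
          resid_add add_ac)
    from runs_wp[OF this] show ?thesis by simp
  qed
  have "runs B append_term (4 + ((t * (11 + 1) + 1) + 1))
      (\<lambda>s'. inv (hs @ [(b, d)]) s' \<and> regs s' rGO = 1) s"
    unfolding append_term_def
    by (intro runs_Seq runs_mono[OF init order_refl] runs_mono[OF loop order_refl] fin)
  then show ?thesis by (rule runs_mono) auto
qed

section \<open>Finding the lowest term of the residual\<close>

definition unchanged :: "reg set \<Rightarrow> state \<Rightarrow> state \<Rightarrow> bool" where
  "unchanged X s s' \<longleftrightarrow> arrs s' = arrs s \<and> (\<forall>x. x \<notin> X \<longrightarrow> regs s' x = regs s x)"

text \<open>The size bound is proved for all partial sums, since the accumulator has to stay small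
  throughout. At most \<open>A ^ 2\<close> entries account for the two extra factors.\<close>

lemma sum_loop_runs:
  assumes m: "regs s rM = int m" "int m \<le> A ^ 2"
    and one: "regs s rONE = 1" and U: "regs s rU = u" "0 \<le> u" "u \<le> A ^ 2"
    and rep: "rep (arrs s aU) (arrs s aV) m p (A ^ 2) (A ^ j)" and j: "j \<le> 10 * \<mu>"
    and start: "regs s rS = 0" "regs s rQ = 0"
  shows "runs B (WhileLess rQ rM sum_body) (m * 8 + 1)
    (\<lambda>s'. unchanged {rS, rQ, rV} s s' \<and> regs s' rS = coeff p (nat u)) s"
    and "\<bar>coeff p (nat u)\<bar> \<le> A ^ (j + 2)"
proof -
  let ?U = "\<lambda>q. arrs s aU (int q)" and ?V = "\<lambda>q. arrs s aV (int q)"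
  define S where "S k = (\<Sum>q<k. if ?U q = u then ?V q else 0)" for k :: nat
  have bounds: "0 \<le> ?U q" "?U q \<le> A ^ 2" "\<bar>?V q\<bar> \<le> A ^ j" if "q < m" for q
    using rep that by (auto simp: rep_def)
  have Sm: "S m = coeff p (nat u)" using rep U(2) by (simp add: rep_def S_def)
  have Sk: "\<bar>S k\<bar> \<le> A ^ (j + 2)" if "k \<le> m" for k
  proof -
    have "\<bar>S k\<bar> \<le> (\<Sum>q<k. \<bar>if ?U q = u then ?V q else 0\<bar>)" unfolding S_def by (rule sum_abs)
    also have "\<dots> \<le> (\<Sum>q<k. A ^ j)" by (rule sum_mono) (use bounds that A in auto)
    also have "\<dots> = int k * A ^ j" by simp
    also have "\<dots> \<le> A ^ 2 * A ^ j" by (rule mult_right_mono) (use that m A in auto)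
    finally show ?thesis by (simp only: power_add mult.commute)
  qed
  show "\<bar>coeff p (nat u)\<bar> \<le> A ^ (j + 2)" using Sk[of m] Sm by simp
  have sS: "small B (S k)" if "k \<le> m" for k
    using small_if_le_power[OF Sk[OF that]] j by simp
  have small2: "small B x" if "\<bar>x\<bar> \<le> A ^ 2" for x by (rule small_if_le_power[OF that]) simp
  define I where "I k s' \<longleftrightarrow> unchanged {rS, rQ, rV} s s' \<and> regs s' rS = S k \<and> regs s' rQ = int k"
    for k s'
  have body: "runs B sum_body 7 (I (Suc k)) s'" if k: "k < m" and s': "I k s'" for k s'
  proof -
    have sm: "small B (int k)" "small B u" "small B (?U k)"
      using k m U bounds[OF k] by (auto intro!: small2)
    have sV: "small B (?V k)" by (rule small_if_le_power[OF bounds(3)[OF k]]) (use j in simp)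
    have Suc: "S (Suc k) = S k + (if ?U k = u then ?V k else 0)" by (simp add: S_def)
    have "wp B sum_body (I (Suc k)) s'"
      using s' k sm sV sS[of k] one U(1) unfolding sum_body_def
      by (auto simp: I_def unchanged_def Suc add_ac)
    from runs_wp[OF this] show ?thesis by (rule runs_mono) (simp_all add: sum_body_def)
  qed
  have "runs B (WhileLess rQ rM sum_body) (m * (7 + 1) + 1)
    (\<lambda>s'. unchanged {rS, rQ, rV} s s' \<and> regs s' rS = coeff p (nat u)) s"
  proof (rule runs_count[where I = I])
    show "I 0 s" using start by (simp add: I_def unchanged_def S_def)
    show "small B (int m)" by (rule small2) (use m in simp)
    show "regs s' rQ = int k \<and> regs s' rM = int m" if "I k s'" for k s'
      using that m by (simp add: I_def unchanged_def)
    show "unchanged {rS, rQ, rV} s s' \<and> regs s' rS = coeff p (nat u)" if "I m s'" for s'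
      using that by (simp add: I_def Sm)
  qed (rule body)
  then show "runs B (WhileLess rQ rM sum_body) (m * 8 + 1)
    (\<lambda>s'. unchanged {rS, rQ, rV} s s' \<and> regs s' rS = coeff p (nat u)) s" by simp
qed

definition lowest_found :: "int poly \<Rightarrow> state \<Rightarrow> bool" where
  "lowest_found p s \<longleftrightarrow> regs s rFOUND = 0 \<and> p = 0 \<or>
     regs s rFOUND = 1 \<and> (\<exists>n. regs s rBEST = int n \<and> regs s rBESTC = coeff p n \<and>
       coeff p n \<noteq> 0 \<and> low n p)"

text \<open>The list is unsorted, hence the quadratic search. That \<open>rBEST\<close> is an entry
  of the list is recorded because it yields a bound on the next exponent even if there is no
  root.\<close>

lemma find_lowest_runs:
  assumes m: "regs s rM = int m" "int m \<le> A ^ 2"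
    and one: "regs s rONE = 1" "regs s rZERO = 0"
    and rep: "rep (arrs s aU) (arrs s aV) m p (A ^ 2) (A ^ j)" and j: "j \<le> 10 * \<mu>"
  shows "runs B find_lowest (m * (m * 8 + 14) + 3)
    (\<lambda>s'. unchanged {rFOUND, rP, rU, rS, rQ, rV, rSQ, rBEST, rBESTC} s s' \<and> lowest_found p s' \<and>
      (regs s' rFOUND = 1 \<longrightarrow> (\<exists>q<m. regs s' rBEST = arrs s aU (int q)) \<and>
        \<bar>regs s' rBESTC\<bar> \<le> A ^ (j + 2))) s"
proof -
  let ?U = "\<lambda>q. arrs s aU (int q)"
  let ?X = "{rFOUND, rP, rU, rS, rQ, rV, rSQ, rBEST, rBESTC} :: reg set"
  have small2: "small B x" if "\<bar>x\<bar> \<le> A ^ 2" for x by (rule small_if_le_power[OF that]) simp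
  have U: "0 \<le> ?U q" "?U q \<le> A ^ 2" if "q < m" for q
    using rep that by (auto simp: rep_def)
  define F where "F k s' \<longleftrightarrow>
     regs s' rFOUND = 0 \<and> (\<forall>q<k. coeff p (nat (?U q)) = 0) \<or>
     regs s' rFOUND = 1 \<and> (\<exists>q<k. regs s' rBEST = ?U q) \<and> coeff p (nat (regs s' rBEST)) \<noteq> 0 \<and>
       regs s' rBESTC = coeff p (nat (regs s' rBEST)) \<and>
       (\<forall>q<k. coeff p (nat (?U q)) \<noteq> 0 \<longrightarrow> regs s' rBEST \<le> ?U q)" for k :: nat and s' :: state
  define I where "I k s' \<longleftrightarrow> unchanged ?X s s' \<and> regs s' rP = int k \<and> F k s'" for k s'
  have body: "runs B (Seq find_pre (Seq (WhileLess rQ rM sum_body) find_post)) (m * 8 + 13) (I (Suc k)) s'"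
    if k: "k < m" and s': "I k s'" for k s'
  proof -
    let ?s1 = "s'\<lparr>regs := (regs s')(rU := ?U k, rS := 0, rQ := 0)\<rparr>"
    let ?c = "coeff p (nat (?U k))"
    have sm: "small B (int k)" "small B (?U k)" using k m U[OF k] by (auto intro!: small2)
    have "wp B find_pre (\<lambda>s''. s'' = ?s1) s'"
      using s' sm unfolding find_pre_def by (simp add: I_def unchanged_def)
    from runs_wp[OF this] have pre: "runs B find_pre 3 (\<lambda>s''. s'' = ?s1) s'"
      by (rule runs_mono) (simp_all add: find_pre_def)
    have a1: "regs ?s1 rM = int m" "regs ?s1 rONE = 1" "regs ?s1 rU = ?U k"
      "rep (arrs ?s1 aU) (arrs ?s1 aV) m p (A ^ 2) (A ^ j)" "regs ?s1 rS = 0" "regs ?s1 rQ = 0"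
      using s' m one rep by (simp_all add: I_def unchanged_def)
    note loop = sum_loop_runs(1)[OF a1(1) m(2) a1(2,3) U[OF k] a1(4) j a1(5,6)]
    note c = sum_loop_runs(2)[OF a1(1) m(2) a1(2,3) U[OF k] a1(4) j a1(5,6)]
    have sc: "small B ?c" by (rule small_if_le_power[OF c]) (use j in simp)
    have "small B (?c * ?c)"
      by (rule small_if_le_power[OF abs_mult_le_power[OF c c order_refl]]) (use j in simp)
    note sc = sc this
    have post: "runs B find_post 9 (I (Suc k)) s2"
      if s2: "unchanged {rS, rQ, rV} ?s1 s2 \<and> regs s2 rS = ?c" for s2
    proof -
      have regs: "regs s2 rFOUND = regs s' rFOUND" "regs s2 rBEST = regs s' rBEST"
        "regs s2 rBESTC = regs s' rBESTC" "regs s2 rP = int k" "regs s2 rU = ?U k"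
        "regs s2 rONE = 1" "regs s2 rZERO = 0"
        using s2 s' one by (simp_all add: unchanged_def I_def)
      have un: "unchanged ?X s s2"
        using s2 s' by (auto simp: unchanged_def I_def)
      have F: "F k s2" using s' by (simp add: I_def F_def regs)
      have sq: "0 < ?c * ?c \<longleftrightarrow> ?c \<noteq> 0" by (auto simp: zero_less_mult_iff)
      have un': "unchanged ?X s s3" if "arrs s3 = arrs s2" "\<forall>x. x \<notin> ?X \<longrightarrow> regs s3 x = regs s2 x" for s3
        using un that unfolding unchanged_def by simp
      have "wp B find_post (\<lambda>s3. arrs s3 = arrs s2 \<and> (\<forall>x. x \<notin> ?X \<longrightarrow> regs s3 x = regs s2 x) \<and>
         regs s3 rP = int (Suc k) \<and>
         (if ?c \<noteq> 0 \<and> (regs s2 rFOUND < 1 \<or> ?U k < regs s2 rBEST)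
          then regs s3 rFOUND = 1 \<and> regs s3 rBEST = ?U k \<and> regs s3 rBESTC = ?c
          else regs s3 rFOUND = regs s2 rFOUND \<and> regs s3 rBEST = regs s2 rBEST \<and> regs s3 rBESTC = regs s2 rBESTC)) s2"
        using s2 sc sm regs unfolding find_post_def find_update_def
        by (auto simp: sq)
      from runs_wp[OF this] show ?thesis
      proof (rule runs_mono)
        fix s3 :: state
        assume s3: "arrs s3 = arrs s2 \<and> (\<forall>x. x \<notin> ?X \<longrightarrow> regs s3 x = regs s2 x) \<and>
         regs s3 rP = int (Suc k) \<and>
         (if ?c \<noteq> 0 \<and> (regs s2 rFOUND < 1 \<or> ?U k < regs s2 rBEST)
          then regs s3 rFOUND = 1 \<and> regs s3 rBEST = ?U k \<and> regs s3 rBESTC = ?c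
          else regs s3 rFOUND = regs s2 rFOUND \<and> regs s3 rBEST = regs s2 rBEST \<and> regs s3 rBESTC = regs s2 rBESTC)"
        have "F (Suc k) s3"
        proof (cases "?c \<noteq> 0 \<and> (regs s2 rFOUND < 1 \<or> ?U k < regs s2 rBEST)")
          case True
          then have r3: "regs s3 rFOUND = 1" "regs s3 rBEST = ?U k" "regs s3 rBESTC = ?c" "?c \<noteq> 0"
            using s3 by simp_all
          have "?U k \<le> ?U q" if "q < k" "coeff p (nat (?U q)) \<noteq> 0" for q
            using F True that unfolding F_def by force
          then have "\<forall>q<Suc k. coeff p (nat (?U q)) \<noteq> 0 \<longrightarrow> ?U k \<le> ?U q"
            by (simp add: less_Suc_eq)
          then show ?thesis unfolding F_def r3 using r3(4) by blast
        next
          case False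
          then have r3: "regs s3 rFOUND = regs s2 rFOUND" "regs s3 rBEST = regs s2 rBEST"
            "regs s3 rBESTC = regs s2 rBESTC" using s3 by (simp_all del: not_less)
          from False have "?c = 0 \<or> \<not> (regs s2 rFOUND < 1) \<and> regs s2 rBEST \<le> ?U k" by linarith
          with F show ?thesis unfolding F_def r3 by (metis less_Suc_eq zero_less_one)
        qed
        then show "I (Suc k) s3" using un' s3 by (simp add: I_def)
      qed (simp add: find_post_def find_update_def)
    qed
    have "runs B (Seq find_pre (Seq (WhileLess rQ rM sum_body) find_post)) (3 + ((m * 8 + 1) + 9)) (I (Suc k)) s'"
    proof (rule runs_Seq, rule runs_mono[OF pre order_refl])
      have "runs B (Seq (WhileLess rQ rM sum_body) find_post) ((m * 8 + 1) + 9) (I (Suc k)) ?s1"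
        by (rule runs_Seq, rule runs_mono[OF loop order_refl], rule post)
      then show "runs B (Seq (WhileLess rQ rM sum_body) find_post) ((m * 8 + 1) + 9) (I (Suc k)) s''"
        if "s'' = ?s1" for s'' using that by (simp only:)
    qed
    then show ?thesis by (rule runs_mono) auto
  qed
  have init: "runs B (Seq (Const rFOUND 0) (Const rP 0)) 2 (I 0) s"
  proof -
    have "wp B (Seq (Const rFOUND 0) (Const rP 0)) (I 0) s"
      by (simp add: I_def F_def unchanged_def)
    from runs_wp[OF this] show ?thesis by (simp add: numeral_2_eq_2)
  qed
  have exit: "unchanged ?X s s' \<and> lowest_found p s' \<and>
      (regs s' rFOUND = 1 \<longrightarrow> (\<exists>q<m. regs s' rBEST = arrs s aU (int q)) \<and>
        \<bar>regs s' rBESTC\<bar> \<le> A ^ (j + 2))" if "I m s'" for s'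
  proof -
    \<comment> \<open>Every exponent with nonzero coefficient is listed, so the minimum over the
      list is the minimum over all exponents.\<close>
    have supp: "\<exists>q<m. ?U q = int n" if "coeff p n \<noteq> 0" for n
    proof (rule ccontr)
      assume "\<not> (\<exists>q<m. ?U q = int n)"
      then have "coeff p n = 0" using rep by (auto simp: rep_def intro!: sum.neutral)
      with that show False by simp
    qed
    have un: "unchanged ?X s s'" and F: "F m s'" using \<open>I m s'\<close> by (auto simp: I_def)
    show ?thesis
    proof (cases "regs s' rFOUND = 0")
      case True
      then have "\<forall>q<m. coeff p (nat (?U q)) = 0" using F by (simp add: F_def)
      then have "p = 0" using supp by (metis coeff_0 nat_int poly_eqI)
      with True un show ?thesis by (simp add: lowest_found_def)
    next
      case False
      then obtain q where 2: "regs s' rFOUND = 1" "q < m" "regs s' rBEST = ?U q"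
        "coeff p (nat (?U q)) \<noteq> 0" "regs s' rBESTC = coeff p (nat (?U q))"
        "\<forall>q'<m. coeff p (nat (?U q')) \<noteq> 0 \<longrightarrow> ?U q \<le> ?U q'"
        using F by (auto simp: F_def)
      have "coeff p i = 0" if "i < nat (?U q)" for i
        using supp[of i] 2(6) that by force
      then have "low (nat (?U q)) p" by (simp add: low_def)
      \<comment> \<open>The bound concerns \<open>p\<close> only; the modified state merely meets
        the hypotheses on registers.\<close>
      moreover have "\<bar>coeff p (nat (?U q))\<bar> \<le> A ^ (j + 2)"
        using sum_loop_runs(2)[of "s\<lparr>regs := (regs s)(rU := ?U q, rS := 0, rQ := 0)\<rparr>" m "?U q" p j]
          m one rep U[OF 2(2)] j by simp
      moreover have "lowest_found p s'"
        using 2 U[OF 2(2)] calculation(1) unfolding lowest_found_def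
        by (intro disjI2 conjI exI[of _ "nat (?U q)"]) auto
      ultimately show ?thesis using 2 un by auto
    qed
  qed
  have loop: "runs B (WhileLess rP rM (Seq find_pre (Seq (WhileLess rQ rM sum_body) find_post)))
     (m * ((m * 8 + 13) + 1) + 1) (\<lambda>s'. unchanged ?X s s' \<and> lowest_found p s' \<and>
      (regs s' rFOUND = 1 \<longrightarrow> (\<exists>q<m. regs s' rBEST = arrs s aU (int q)) \<and>
        \<bar>regs s' rBESTC\<bar> \<le> A ^ (j + 2))) s'" if "I 0 s'" for s'
  proof (rule runs_count[where I = I])
    show "small B (int m)" by (rule small2) (use m in simp)
    show "regs s' rP = int k \<and> regs s' rM = int m" if "I k s'" for k s'
      using that m by (simp add: I_def unchanged_def)
  qed (rule that, erule body, assumption, erule exit)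
  have "runs B find_lowest (2 + (m * ((m * 8 + 13) + 1) + 1)) (\<lambda>s'. unchanged ?X s s' \<and> lowest_found p s' \<and>
      (regs s' rFOUND = 1 \<longrightarrow> (\<exists>q<m. regs s' rBEST = arrs s aU (int q)) \<and>
        \<bar>regs s' rBESTC\<bar> \<le> A ^ (j + 2))) s"
    unfolding find_lowest_def by (intro runs_Seq runs_mono[OF init order_refl] loop)
  then show ?thesis by (rule runs_mono) auto
qed

section \<open>Partial roots\<close>

definition answer :: "state \<Rightarrow> bool" where
  "answer s \<longleftrightarrow> (if \<exists>h. f = h ^ r \<and> sparse \<mu> h
     then \<exists>h. f = h ^ r \<and> sparse \<mu> h \<and> returns s (lacunary h)
     else reports_failure s)"

lemma f_low: "low e0 f" "coeff f e0 = c0" "c0 \<noteq> 0"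
proof -
  have cs: "cs = cs ! 0 # tl cs" using length_ge by (cases cs) auto
  have "reduced (cs ! 0 # tl cs)" using reduced cs by simp
  from low_poly_of[OF this] show "low e0 f" "coeff f e0 = c0" "c0 \<noteq> 0" by (simp_all flip: cs)
qed

lemma first_le: "\<bar>c0\<bar> \<le> A" "int e0 \<le> A"
proof -
  have "0 < t" using length_ge by linarith
  from cs_nth_le[OF this] show "\<bar>c0\<bar> \<le> A" "int e0 \<le> A" by simp_all
qed

lemma root_low:
  assumes "f = h ^ r"
  obtains d where "r * d = e0" "low d h" "coeff h d ^ r = c0"
proof -
  have "h \<noteq> 0" using assms f_low r by (auto simp: power_0_left)
  then obtain d where d: "low d h" "coeff h d \<noteq> 0" by (rule low_exists)
  have "low (r * d) f" "coeff f (r * d) = coeff h d ^ r" using low_power[OF d(1), of r] assms by auto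
  moreover from this have "r * d = e0"
    using f_low d(2) unfolding low_def by (metis nat_neq_iff power_not_zero)
  ultimately show ?thesis using that d f_low by metis
qed

text \<open>Integers with equal \<open>r\<close>th powers, \<open>r > 0\<close>, differ at most in
  sign. A differing sign forces \<open>r\<close> to be even because \<open>c0\<close> is nonzero,
  and then \<open>- h\<close> is a root with the same number of terms. So refuting roots with one
  fixed lowest coefficient refutes all sparse roots.\<close>

lemma root_sign:
  assumes "f = h ^ r" "sparse \<mu> h" "b0 ^ r = c0" "r * d0 = e0"
  obtains h' where "f = h' ^ r" "sparse \<mu> h'" "low d0 h'" "coeff h' d0 = b0"
proof -
  obtain d where d: "r * d = e0" "low d h" "coeff h d ^ r = c0" using assms(1) by (rule root_low)
  then have "r * d = r * d0" using assms(4) by simp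
  then have [simp]: "d = d0" using r(1) by simp
  have "\<bar>coeff h d\<bar> ^ r = \<bar>b0\<bar> ^ r" using d(3) assms(3) by (simp flip: power_abs)
  then have abs: "\<bar>coeff h d\<bar> = \<bar>b0\<bar>" using r by (metis abs_ge_zero power_eq_imp_eq_base)
  show ?thesis
  proof (cases "coeff h d = b0")
    case True
    then show ?thesis using that assms d by simp
  next
    case False
    then have neg: "coeff h d = - b0" using abs by linarith
    have "even r"
    proof (rule ccontr)
      assume "odd r"
      then have "c0 = - c0" using d(3) assms(3) neg by (simp add: power_minus_odd)
      then show False using f_low(3) by simp
    qed
    then have "f = (- h) ^ r" using assms(1) by simp
    moreover have "sparse \<mu> (- h)" using assms(2) by (simp add: sparse_def num_terms_def)
    ultimately show ?thesis using that[of "- h"] d(2) neg by (simp add: low_def)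
  qed
qed

text \<open>The condition on the order of the residual holds with or without a root and forces the
  next exponent to be larger. The last clause, vacuous if no root has this lowest term, says that
  the terms so far were forced.\<close>

definition good :: "int \<Rightarrow> nat \<Rightarrow> (int \<times> nat) list \<Rightarrow> bool" where
  "good b0 d0 hs \<longleftrightarrow> hs \<noteq> [] \<and> hs ! 0 = (b0, d0) \<and> reduced hs \<and> length hs \<le> \<mu> \<and>
     int (snd (last hs)) \<le> A * int (length hs) \<and>
     low (e0 + snd (last hs) + 1) (resid f r (poly_of hs)) \<and>
     (\<forall>h. f = h ^ r \<and> coeff h d0 = b0 \<and> low d0 h \<longrightarrow>
        (\<forall>n\<le>snd (last hs). coeff h n = coeff (poly_of hs) n))"

lemma coeff_beyond_last:
  assumes "reduced hs" "hs \<noteq> []"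
  shows "n > snd (last hs) \<Longrightarrow> coeff (poly_of hs) n = 0"
proof -
  have s: "sorted_wrt (<) (map snd hs)" using assms by (simp add: reduced_def)
  have "e \<le> snd (last hs)" if e: "e \<in> snd ` set hs" for e
  proof -
    have "sorted (map snd hs)" using s by (simp add: strict_sorted_iff)
    moreover obtain i where "i < length (map snd hs)" "map snd hs ! i = e"
      using e in_set_conv_nth[of e "map snd hs"] by auto
    moreover have "snd (last hs) = map snd hs ! (length hs - 1)" using assms(2) by (simp add: last_conv_nth)
    ultimately show ?thesis using sorted_nth_mono[of "map snd hs" i "length hs - 1"] by auto
  qed
  then show "n > snd (last hs) \<Longrightarrow> coeff (poly_of hs) n = 0" using coeff_poly_of[OF s] by fastforce
qed

context
  fixes b0 d0 hs
  assumes b0: "b0 ^ r = c0" and d0: "r * d0 = e0" and good: "good b0 d0 hs"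
begin

lemma good_simps: "hs \<noteq> []" "hs ! 0 = (b0, d0)" "reduced hs" "length hs \<le> \<mu>"
  "sorted_wrt (<) (map snd hs)" "d0 \<le> snd (last hs)" "b0 \<noteq> 0"
proof -
  show *: "hs \<noteq> []" "hs ! 0 = (b0, d0)" "reduced hs" "length hs \<le> \<mu>"
    using good by (simp_all add: good_def)
  show s: "sorted_wrt (<) (map snd hs)" using \<open>reduced hs\<close> by (simp add: reduced_def)
  then have "sorted (map snd hs)" by (simp add: strict_sorted_iff)
  from sorted_nth_mono[OF this, of 0 "length hs - 1"] show "d0 \<le> snd (last hs)"
    using * by (simp add: last_conv_nth)
  show "b0 \<noteq> 0" using b0 f_low(3) r by (auto simp: power_0_left)
qed

lemma good_low: "low d0 (poly_of hs)" "coeff (poly_of hs) d0 = b0"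
proof -
  have "hs = (b0, d0) # tl hs" using good_simps(1,2) by (cases hs) auto
  with low_poly_of[of "(b0, d0)" "tl hs"] good_simps(3)
  show "low d0 (poly_of hs)" "coeff (poly_of hs) d0 = b0" by auto
qed

lemma good_exact:
  assumes "resid f r (poly_of hs) = 0"
  shows "f = poly_of hs ^ r"
  using resid_eq_0_imp_power[OF assms, of d0] f_low good_low b0 d0 r by simp

text \<open>The first claim assumes no root, which keeps the list sorted in every run. For a root
  \<open>h\<close>, the exponents found so far and the new one all occur in \<open>h\<close>, so
  \<open>\<mu>\<close> terms with a nonzero residual contradict sparsity.\<close>

lemma good_next:
  assumes n: "low n (resid f r (poly_of hs))" "coeff (resid f r (poly_of hs)) n \<noteq> 0"
  shows "e0 + snd (last hs) < n"
    and "f = h ^ r \<Longrightarrow> coeff h d0 = b0 \<Longrightarrow> low d0 h \<Longrightarrow>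
      - coeff (resid f r (poly_of hs)) n
        = coeff h (n - e0) * ((int r * int (n - e0) - int e0) * c0) \<and>
      low (n - e0) (h - poly_of hs) \<and> (sparse \<mu> h \<longrightarrow> length hs < \<mu>)"
proof -
  have "low (e0 + snd (last hs) + 1) (resid f r (poly_of hs))" using good by (simp add: good_def)
  then have "\<not> n < e0 + snd (last hs) + 1" using n(2) unfolding low_def by blast
  then show "e0 + snd (last hs) < n" by simp
  assume h: "f = h ^ r" "coeff h d0 = b0" "low d0 h"
  let ?d = "snd (last hs)"
  have agree: "coeff (poly_of hs) i = coeff h i" if "i \<le> ?d" for i
    using good h that by (simp add: good_def)
  obtain d' where d': "?d < d'" "n = r * d0 + d'" "low d' (h - poly_of hs)" "coeff h d' \<noteq> 0"
    "- coeff (resid f r (poly_of hs)) n = coeff h d' * (coeff f (r * d0) * (of_nat r * of_nat d' - of_nat (r * d0)))"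
    using resid_next_term(2)[OF h(1,3) _ r(1) good_simps(6) agree coeff_beyond_last[OF good_simps(3,1)] n]
      h(2) good_simps(7) by auto
  have "length hs < \<mu>" if "sparse \<mu> h"
  proof -
    have "insert d' (snd ` set hs) \<subseteq> {i. coeff h i \<noteq> 0}"
    proof -
      have "coeff h e \<noteq> 0" if e: "e \<in> snd ` set hs" for e
      proof -
        obtain c where c: "(c, e) \<in> set hs" using e by auto
        then have 1: "coeff (poly_of hs) e = c" using coeff_poly_of[OF good_simps(5)] by auto
        have "c \<noteq> 0" using c good_simps(3) by (force simp: reduced_def)
        then have "e \<le> ?d" using 1 coeff_beyond_last[OF good_simps(3,1), of e] by (meson not_le)
        then show ?thesis using agree 1 \<open>c \<noteq> 0\<close> by simp
      qed
      then show ?thesis using d'(4) by auto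
    qed
    from card_mono[OF finite_coeffs this] have le: "card (insert d' (snd ` set hs)) \<le> \<mu>"
      using that by (simp add: sparse_def num_terms_def)
    have "d' \<notin> snd ` set hs"
    proof
      assume "d' \<in> snd ` set hs"
      then obtain c where c: "(c, d') \<in> set hs" by auto
      then have "coeff (poly_of hs) d' = c" using coeff_poly_of[OF good_simps(5)] by auto
      moreover have "c \<noteq> 0" using c good_simps(3) by (force simp: reduced_def)
      ultimately show False using coeff_beyond_last[OF good_simps(3,1) d'(1)] by simp
    qed
    moreover have "card (snd ` set hs) = length hs"
      using good_simps(5) distinct_card[of "map snd hs"] by (simp add: strict_sorted_iff)
    ultimately show ?thesis using le by simp
  qed
  moreover have "n - e0 = d'" using d'(2) d0 by simp
  ultimately show "- coeff (resid f r (poly_of hs)) n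
        = coeff h (n - e0) * ((int r * int (n - e0) - int e0) * c0) \<and>
      low (n - e0) (h - poly_of hs) \<and> (sparse \<mu> h \<longrightarrow> length hs < \<mu>)"
    using d'(3) d'(5)[unfolded d0 f_low(2)] by (simp add: mult.commute)
qed

text \<open>The coefficient \<open>b\<close> is chosen so that the residual of the new monomial
  cancels the lowest term of the old residual; hence the order rises. The same equation determines
  the coefficient of any root, so the agreement extends by one term.\<close>

lemma good_snoc:
  assumes n: "low n (resid f r (poly_of hs))" "coeff (resid f r (poly_of hs)) n \<noteq> 0"
    and b: "b * ((int r * int (n - e0) - int e0) * c0) = - coeff (resid f r (poly_of hs)) n"
    and len: "length hs < \<mu>" and le: "int (n - e0) \<le> A * (int (length hs) + 1)"
  shows "good b0 d0 (hs @ [(b, n - e0)])"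
proof -
  let ?d = "n - e0" and ?hs = "hs @ [(b, n - e0)]"
  let ?w = "resid f r (poly_of hs)"
  have d: "snd (last hs) < ?d" using good_next(1)[OF n] by simp
  have "b \<noteq> 0" using b n(2) by auto
  have en: "e0 + ?d = n" using good_next(1)[OF n] by simp
  have mon: "low ?d (monom b ?d)" by (simp add: low_def)
  have "low n (resid f r (monom b ?d))" "coeff (resid f r (monom b ?d)) n = - coeff ?w n"
    using low_resid[OF f_low(1) mon, of r] f_low(2) b en by (simp_all add: mult_ac)
  moreover have "resid f r (poly_of ?hs) = ?w + resid f r (monom b ?d)"
    by (simp add: poly_of_append poly_of_Cons resid_add)
  ultimately have "low (n + 1) (resid f r (poly_of ?hs))"
    using n(1) by (auto simp: low_def less_Suc_eq)
  moreover have "coeff h i = coeff (poly_of ?hs) i"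
    if h: "f = h ^ r" "coeff h d0 = b0" "low d0 h" and i: "i \<le> ?d" for h i
  proof -
    note nx = good_next(2)[OF n h]
    show ?thesis
    proof (cases "i = ?d")
      case True
      have "coeff h ?d * ((int r * int ?d - int e0) * c0) = b * ((int r * int ?d - int e0) * c0)"
        unfolding b using conjunct1[OF nx] by (rule sym)
      \<comment> \<open>The product with \<open>b\<close> is nonzero, hence so is this factor, and
        it may be cancelled.\<close>
      moreover have "(int r * int ?d - int e0) * c0 \<noteq> 0"
        using b n(2) by (metis mult_zero_right neg_equal_0_iff_equal)
      ultimately have "coeff h ?d = b" by simp
      then show ?thesis using True coeff_beyond_last[OF good_simps(3,1) d]
        by (simp add: poly_of_append poly_of_Cons)
    next
      case False
      then have "i < ?d" using i by simp
      then have "coeff (h - poly_of hs) i = 0" using nx by (simp add: low_def)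
      then show ?thesis using \<open>i < ?d\<close> by (simp add: poly_of_append poly_of_Cons)
    qed
  qed
  moreover have "reduced ?hs"
  proof -
    have "e < ?d" if e: "e \<in> snd ` set hs" for e
    proof -
      obtain c where c: "(c, e) \<in> set hs" using e by auto
      then have 1: "coeff (poly_of hs) e = c" using coeff_poly_of[OF good_simps(5)] by auto
      have "c \<noteq> 0" using c good_simps(3) by (force simp: reduced_def)
      then have "e \<le> snd (last hs)" using 1 coeff_beyond_last[OF good_simps(3,1), of e] by (meson not_le)
      then show ?thesis using d by simp
    qed
    then show ?thesis using good_simps(3) \<open>b \<noteq> 0\<close> by (auto simp: reduced_def sorted_wrt_append)
  qed
  moreover have "?hs ! 0 = (b0, d0)" using good_simps(1,2) by (simp add: nth_append)
  ultimately show ?thesis using len le en unfolding good_def by (simp add: add_ac)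
qed

end

lemma good_init:
  assumes "b0 ^ r = c0" "r * d0 = e0" "int d0 \<le> A"
  shows "good b0 d0 [(b0, d0)]"
proof -
  have "b0 \<noteq> 0" using assms(1) f_low(3) r by (auto simp: power_0_left)
  have mon: "low d0 (monom b0 d0)" by (simp add: low_def)
  note lr = low_resid[OF f_low(1) mon, of r]
  \<comment> \<open>The indicial factor vanishes at \<open>d0\<close>, so the residual of the first
    monomial already starts above \<open>e0 + d0\<close>.\<close>
  have "of_nat r * of_nat d0 - (of_nat e0 :: int) = 0" using assms(2) by (simp flip: of_nat_mult)
  then have "low (e0 + d0 + 1) (resid f r (monom b0 d0))"
    using lr by (auto simp: low_def less_Suc_eq)
  then show ?thesis using \<open>b0 \<noteq> 0\<close> \<mu> assms(3)
    by (auto simp: good_def reduced_def poly_of_Cons low_def)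
qed

section \<open>One round and the main loop\<close>

lemma answer_failure:
  assumes "regs s rOUT = -1" "\<not> (\<exists>h. f = h ^ r \<and> sparse \<mu> h)"
  shows "answer s"
  using assms(1) unfolding answer_def if_not_P[OF assms(2)] by (simp add: reports_failure_def)

lemma next_term_runs:
  assumes b0: "b0 ^ r = c0" "r * d0 = e0" and good: "good b0 d0 hs"
    and inv: "inv hs s" and found: "lowest_found (resid f r (poly_of hs)) s"
    and best: "regs s rFOUND = 1 \<longrightarrow> (\<exists>q<length hs * t. regs s rBEST = arrs s aU (int q)) \<and>
        \<bar>regs s rBESTC\<bar> \<le> A ^ (10 * length hs + 2)"
  shows "runs B next_term (t * 12 + 18) (\<lambda>s'. (regs s' rGO = 1 \<and> (\<exists>hs'. length hs' = Suc (length hs) \<and>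
      good b0 d0 hs' \<and> inv hs' s')) \<or> (regs s' rGO = 0 \<and> regs s' rZERO = 0 \<and> answer s')) s"
    (is "runs B _ _ ?Q s")
proof -
  let ?w = "resid f r (poly_of hs)" and ?k = "length hs"
  note gs = good_simps[OF b0 good]
  have kA: "int ?k + 2 \<le> A" using \<mu>_le gs(4) by simp
  have sk: "small B (int ?k)" by (rule small_if_le) (use kA in auto)
  have base: "base s" using inv by (simp add: inv_def)
  have stop: "runs B (Const rGO 0) 1 ?Q s'"
    if "base s'" "\<not> (\<exists>h. f = h ^ r \<and> sparse \<mu> h)" for s'
  proof -
    have "wp B (Const rGO 0) ?Q s'"
      using answer_failure[of "s'\<lparr>regs := (regs s')(rGO := 0)\<rparr>"] that by (simp add: base_def)
    from runs_wp[OF this] show ?thesis by simp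
  qed
  have "runs B next_term (Suc (t * 12 + 17)) ?Q s"
    unfolding next_term_def
  proof (rule runs_IfLess)
    show "small B (regs s rZERO) \<or> small B (regs s rFOUND)" using base by (simp add: base_def)
  next
    assume "\<not> regs s rZERO < regs s rFOUND"
    then have w: "?w = 0" using found base by (auto simp: lowest_found_def base_def)
    have f: "f = poly_of hs ^ r" by (rule good_exact[OF b0 good w])
    have sp: "sparse \<mu> (poly_of hs)" using lacunary_poly_of(2)[OF gs(3)] gs(4) by (simp add: sparse_def)
    have "answer s'" if "stored hs s'" "regs s' rOUT = int ?k" for s'
    proof -
      have "returns s' (lacunary (poly_of hs))"
        using that lacunary_poly_of(1)[OF gs(3)] by (simp add: returns_def stored_def)
      moreover have ex: "\<exists>h. f = h ^ r \<and> sparse \<mu> h" using f sp by blast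
      ultimately show ?thesis using f sp unfolding answer_def if_P[OF ex] by blast
    qed
    then have "wp B (Seq (Op Add rOUT rK rZERO) (Const rGO 0)) ?Q s"
      using inv sk by (simp add: inv_def base_def stored_def)
    from runs_wp[OF this] show "runs B (Seq (Op Add rOUT rK rZERO) (Const rGO 0)) (t * 12 + 17) ?Q s"
      by (rule runs_mono) auto
  next
    assume "regs s rZERO < regs s rFOUND"
    then obtain n where n: "regs s rFOUND = 1" "regs s rBEST = int n" "regs s rBESTC = coeff ?w n"
      "coeff ?w n \<noteq> 0" "low n ?w"
      using found base by (auto simp: lowest_found_def base_def)
    note nx = good_next[OF b0 good n(5,4)]
    let ?c = "coeff ?w n" and ?d = "n - e0"
    have "runs B (IfLess rK rMU (Seq next_init (IfLess rZERO rW (Const rGO 0) append_term)) (Const rGO 0))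
      (Suc (t * 12 + 16)) ?Q s"
    proof (rule runs_IfLess)
      show "small B (regs s rK) \<or> small B (regs s rMU)" using base by (simp add: base_def)
    next
      assume "\<not> regs s rK < regs s rMU"
      then have "\<not> ?k < \<mu>" using inv by (simp add: inv_def base_def)
      \<comment> \<open>A sparse root, normalised by \<open>root_sign\<close>, would need a further
        term beyond the \<open>\<mu>\<close> found.\<close>
      then have "\<not> (\<exists>h. f = h ^ r \<and> sparse \<mu> h)"
        using nx(2) root_sign[OF _ _ b0] by metis
      then show "runs B (Const rGO 0) (t * 12 + 16) ?Q s"
        by (intro runs_mono[OF stop[OF base]]) auto
    next
      assume "regs s rK < regs s rMU"
      then have len: "?k < \<mu>" using inv by (simp add: inv_def base_def)
      have nA: "int n \<le> A * (int ?k + 1)"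
        using best n inv by (auto simp: inv_def rep_def)
      have c: "\<bar>?c\<bar> \<le> A ^ (10 * ?k + 2)" using best n by simp
      have dn: "int ?d = int n - int e0" using nx(1) by simp
      have A2: "A * (int ?k + 1) \<le> A ^ 2" using kA A by (simp add: power2_eq_square)
      have d2: "int ?d \<le> A ^ 2" using nA dn A2 by linarith
      note c0 = first_le(1) and e0 = first_le(2)
      let ?y1 = "int r * int ?d"
      let ?y = "(?y1 - int e0) * c0"
      let ?b = "(- ?c) div ?y"
      let ?z = "?b * ?y - (- ?c)"
      have y1: "\<bar>?y1\<bar> \<le> A ^ 3"
        by (rule abs_mult_le_power[of _ 1 _ 2]) (use r length_le d2 in auto)
      have "A \<le> A ^ 3" using power_A_mono[of 1 3] by simp
      moreover have "0 \<le> ?y1" "0 \<le> int e0" by simp_all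
      ultimately have y2: "\<bar>?y1 - int e0\<bar> \<le> A ^ 3" using y1 e0 by linarith
      have y: "\<bar>?y\<bar> \<le> A ^ 4" by (rule abs_mult_le_power[OF y2, of _ 1]) (use c0 in auto)
      have b: "\<bar>?b\<bar> \<le> A ^ (10 * ?k + 2)" using abs_div_le[of "- ?c" ?y] c by simp
      have by': "\<bar>?b * ?y\<bar> \<le> A ^ (10 * ?k + 6)" by (rule abs_mult_le_power[OF b y]) simp
      have z: "\<bar>?z\<bar> \<le> A ^ (10 * ?k + 7)"
      proof -
        have "A ^ (10 * ?k + 2) \<le> A ^ (10 * ?k + 6)" by (rule power_A_mono) simp
        then have "\<bar>?z\<bar> \<le> 2 * A ^ (10 * ?k + 6)" using by' c by linarith
        also have "\<dots> \<le> A * A ^ (10 * ?k + 6)" by (rule mult_right_mono) (use A in auto)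
        also have "\<dots> = A ^ (10 * ?k + 7)" using power_Suc[of A "10 * ?k + 6"] by (simp only: Suc_eq_plus1 add.assoc) simp
        finally show ?thesis .
      qed
      have zz: "\<bar>?z * ?z\<bar> \<le> A ^ (20 * ?k + 14)" by (rule abs_mult_le_power[OF z z]) simp
      have sm: "small B (int n)" "small B (int e0)" "small B (int ?d)" "small B ?y1" "small B (?y1 - int e0)"
        "small B c0" "small B ?c" "small B (- ?c)" "small B ?y" "small B ?b" "small B (?b * ?y)" "small B ?z"
      proof -
        show "small B (int n)" "small B (int ?d)"
          using nA A2 d2 by (auto intro!: small_if_le_power[of _ 2])
        show "small B (int e0)" "small B c0" using e0 c0 by (auto intro!: small_if_le)
        show "small B ?y1" "small B (?y1 - int e0)" "small B ?y" "small B ?b" "small B (?b * ?y)" "small B ?z"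
          by (rule small_if_le_power[OF y1] small_if_le_power[OF y2] small_if_le_power[OF y] small_if_le_power[OF b]
             small_if_le_power[OF by'] small_if_le_power[OF z], use len in simp)+
        show "small B ?c" "small B (- ?c)"
          by (rule small_if_le_power[of _ "10 * ?k + 2"]; use c len in simp)+
      qed
      have szz: "small B (?z * ?z)" by (rule small_if_le_power[OF zz]) (use len in simp)
      let ?s' = "\<lambda>s'. inv hs s' \<and> regs s' rB = ?b \<and> regs s' rD = int ?d \<and> regs s' rW = ?z * ?z"
      have init: "runs B next_init 9 ?s' s"
      proof -
        note sm' = sm(1-2) sm(3-12)[unfolded dn]
        have "wp B next_init ?s' s"
          using inv n sm' szz[unfolded dn] unfolding next_init_def
          by (simp add: inv_def base_def stored_def dn)
        from runs_wp[OF this] show ?thesis by (rule runs_mono) (simp_all add: next_init_def)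
      qed
      have rest: "runs B (IfLess rZERO rW (Const rGO 0) append_term) (Suc (t * 12 + 6)) ?Q s'"
        if s': "?s' s'" for s'
      proof (rule runs_IfLess)
        show "small B (regs s' rZERO) \<or> small B (regs s' rW)" using s' by (simp add: inv_def base_def)
      next
        assume "regs s' rZERO < regs s' rW"
        then have ne: "?b * ?y \<noteq> - ?c" using s' by (auto simp: inv_def base_def)
        \<comment> \<open>The coefficient of a root would be an exact integer quotient.\<close>
        have "\<not> (\<exists>h. f = h ^ r \<and> sparse \<mu> h)"
        proof
          assume "\<exists>h. f = h ^ r \<and> sparse \<mu> h"
          then obtain h where "f = h ^ r" "low d0 h" "coeff h d0 = b0"
            using root_sign[OF _ _ b0] by metis
          with nx(2) have "- ?c = coeff h ?d * ?y" by simp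
          with ne show False by (metis dvd_div_mult_self dvd_triv_right)
        qed
        then show "runs B (Const rGO 0) (t * 12 + 6) ?Q s'"
          using s' by (intro runs_mono[OF stop]) (auto simp: inv_def)
      next
        assume "\<not> regs s' rZERO < regs s' rW"
        then have "?z = 0" using s' by (auto simp: inv_def base_def zero_less_mult_iff)
        then have eq: "?b * ?y = - ?c" by simp
        have dA: "int ?d \<le> A * (int ?k + 1)" using nA dn by linarith
        have g: "good b0 d0 (hs @ [(?b, ?d)])" by (rule good_snoc[OF b0 good n(5,4) eq len dA])
        have b3: "\<bar>?b\<bar> \<le> A ^ (10 * ?k + 3)" using b power_A_mono[of "10 * ?k + 2" "10 * ?k + 3"] by linarith
        have "runs B append_term (t * 12 + 6) (\<lambda>s''. inv (hs @ [(?b, ?d)]) s'' \<and> regs s'' rGO = 1) s'"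
          by (rule append_term_runs) (use s' dA b3 len in auto)
        then show "runs B append_term (t * 12 + 6) ?Q s'"
        proof (rule runs_mono[OF _ order_refl])
          fix s'' assume "inv (hs @ [(?b, ?d)]) s'' \<and> regs s'' rGO = 1"
          with g show "?Q s''" by (intro disjI1 conjI exI[of _ "hs @ [(?b, ?d)]"]) auto
        qed
      qed
      have "runs B (Seq next_init (IfLess rZERO rW (Const rGO 0) append_term)) (9 + Suc (t * 12 + 6)) ?Q s"
        by (rule runs_Seq, rule runs_mono[OF init order_refl], rule rest)
      then show "runs B (Seq next_init (IfLess rZERO rW (Const rGO 0) append_term)) (t * 12 + 16) ?Q s"
        by (rule runs_mono) auto
    qed
    then show "runs B (IfLess rK rMU (Seq next_init (IfLess rZERO rW (Const rGO 0) append_term)) (Const rGO 0))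
      (t * 12 + 17) ?Q s" by (rule runs_mono) auto
  qed
  then show ?thesis by (rule runs_mono) auto
qed

lemma root_loop_runs:
  assumes b0: "b0 ^ r = c0" "r * d0 = e0" and s: "base s" "regs s rB = b0" "regs s rD = int d0"
  shows "runs B root_loop (t * 12 + 9 + (\<mu> + 1) * (\<mu> * t * (\<mu> * t * 8 + 14) + t * 12 + 22)) answer s"
proof -
  have "d0 \<le> r * d0" using r by simp
  then have d0A: "int d0 \<le> A" using b0(2) first_le by simp
  \<comment> \<open>An integer is dominated by its positive powers, so the first coefficient of the
    root is bounded by that of \<open>f\<close>.\<close>
  have "\<bar>b0\<bar> \<le> \<bar>b0\<bar> ^ r"
    using r self_le_power[of "\<bar>b0\<bar>" r] by (cases "b0 = 0") auto
  also have "\<dots> = \<bar>c0\<bar>" using b0(1) by (simp flip: power_abs)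
  finally have b0A: "\<bar>b0\<bar> \<le> A" using first_le by simp
  have init: "runs B (Seq (Const rK 0) (Const rM 0)) 2
    (\<lambda>s'. inv [] s' \<and> regs s' rB = b0 \<and> regs s' rD = int d0) s"
  proof -
    have "wp B (Seq (Const rK 0) (Const rM 0)) (\<lambda>s'. inv [] s' \<and> regs s' rB = b0 \<and> regs s' rD = int d0) s"
      using s by (simp add: inv_def base_def stored_def rep_0)
    from runs_wp[OF this] show ?thesis by (simp add: numeral_2_eq_2)
  qed
  have app: "runs B append_term (t * 12 + 6) (\<lambda>s''. inv [(b0, d0)] s'' \<and> regs s'' rGO = 1) s'"
    if "inv [] s' \<and> regs s' rB = b0 \<and> regs s' rD = int d0" for s'
  proof -
    have "\<bar>b0\<bar> \<le> A ^ (10 * length ([] :: (int \<times> nat) list) + 3)"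
      using b0A power_A_mono[of 1 3] by simp
    from append_term_runs[where hs = "[]" and s = s' and b = b0 and d = d0, OF _ _ _ _ this] that d0A show ?thesis by simp
  qed
  define I where "I s' \<longleftrightarrow> (regs s' rGO = 1 \<and> (\<exists>hs. good b0 d0 hs \<and> inv hs s')) \<or>
     (regs s' rGO = 0 \<and> regs s' rZERO = 0 \<and> answer s')" for s'
  \<comment> \<open>The \<open>+ 1\<close> keeps the variant positive at \<open>\<mu>\<close> terms,
    so that the stopping round, which sets it to 0, still decreases it.\<close>
  define V where "V s' = (if regs s' rGO = 1 then nat (int \<mu> + 1 - regs s' rK) else 0)" for s' :: state
  let ?N = "\<mu> * t"
  let ?m = "?N * (?N * 8 + 14) + t * 12 + 21"
  have body: "runs B (Seq find_lowest next_term) ?m (\<lambda>s''. I s'' \<and> V s'' < V s') s'"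
    if I: "I s'" and go: "regs s' rZERO < regs s' rGO" for s'
  proof -
    obtain hs where hs: "good b0 d0 hs" "inv hs s'" and go1: "regs s' rGO = 1"
      using I go by (auto simp: I_def)
    let ?k = "length hs" and ?p = "resid f r (poly_of hs)"
    have k: "?k \<le> \<mu>" using good_simps(4)[OF b0 hs(1)] .
    then have kA: "int ?k + 2 \<le> A" using \<mu>_le by simp
    have regs: "regs s' rM = int (?k * t)" "regs s' rONE = 1" "regs s' rZERO = 0" "regs s' rK = int ?k"
      using hs(2) by (simp_all add: inv_def base_def)
    have "int (?k * t) \<le> A * A" unfolding of_nat_mult by (rule mult_mono) (use kA length_le A in auto)
    then have m: "int (?k * t) \<le> A ^ 2" by (simp only: power2_eq_square)
    have "A * (int ?k + 1) \<le> A ^ 2" using kA A by (simp add: power2_eq_square)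
    then have rep: "rep (arrs s' aU) (arrs s' aV) (?k * t) ?p (A ^ 2) (A ^ (10 * ?k))"
      using hs(2) unfolding inv_def by (elim conjE rep_mono) auto
    have j: "10 * ?k \<le> 10 * \<mu>" using k by simp
    note find = find_lowest_runs[OF regs(1) m regs(2,3) rep j]
    let ?F = "\<lambda>s1. unchanged {rFOUND, rP, rU, rS, rQ, rV, rSQ, rBEST, rBESTC} s' s1 \<and> lowest_found ?p s1 \<and>
      (regs s1 rFOUND = 1 \<longrightarrow> (\<exists>q<?k * t. regs s1 rBEST = arrs s' aU (int q)) \<and>
        \<bar>regs s1 rBESTC\<bar> \<le> A ^ (10 * ?k + 2))"
    have nxt: "runs B next_term (t * 12 + 18) (\<lambda>s''. I s'' \<and> V s'' < V s') s1" if s1: "?F s1" for s1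
    proof -
      have inv1: "inv hs s1" and arrs: "arrs s1 = arrs s'"
        using s1 hs(2) by (simp_all add: unchanged_def inv_def base_def stored_def)
      have best: "regs s1 rFOUND = 1 \<longrightarrow> (\<exists>q<?k * t. regs s1 rBEST = arrs s1 aU (int q)) \<and>
        \<bar>regs s1 rBESTC\<bar> \<le> A ^ (10 * ?k + 2)" using s1 unfolding arrs by blast
      show ?thesis
      proof (rule runs_mono[OF next_term_runs[OF b0 hs(1) inv1 _ best] order_refl])
        show "lowest_found ?p s1" using s1 by blast
        fix s'' assume s'': "(regs s'' rGO = 1 \<and> (\<exists>hs'. length hs' = Suc ?k \<and>
          good b0 d0 hs' \<and> inv hs' s'')) \<or> (regs s'' rGO = 0 \<and> regs s'' rZERO = 0 \<and> answer s'')"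
        have V: "V s' = \<mu> + 1 - ?k" "0 < V s'" using go1 regs(4) k by (simp_all add: V_def nat_diff_distrib)
        from s'' show "I s'' \<and> V s'' < V s'"
        proof
          assume "regs s'' rGO = 1 \<and> (\<exists>hs'. length hs' = Suc ?k \<and> good b0 d0 hs' \<and> inv hs' s'')"
          then obtain hs' where hs': "regs s'' rGO = 1" "length hs' = Suc ?k" "good b0 d0 hs'" "inv hs' s''"
            by blast
          moreover from this have "V s'' = \<mu> + 1 - Suc ?k"
            using good_simps(4)[OF b0 hs'(3)] by (simp add: V_def inv_def)
          ultimately show ?thesis using V by (auto simp: I_def)
        next
          assume "regs s'' rGO = 0 \<and> regs s'' rZERO = 0 \<and> answer s''"
          then show ?thesis using V by (simp add: I_def V_def)
        qed
      qed
    qed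
    have run: "runs B (Seq find_lowest next_term) (?k * t * (?k * t * 8 + 14) + 3 + (t * 12 + 18))
      (\<lambda>s''. I s'' \<and> V s'' < V s') s'"
      by (rule runs_Seq, rule runs_mono[OF find order_refl], rule nxt)
    have "?k * t \<le> ?N" using k by (rule mult_le_mono1)
    then have "?k * t * (?k * t * 8 + 14) \<le> ?N * (?N * 8 + 14)"
      using mult_le_mono[OF _ add_le_mono1[OF mult_le_mono1]] by blast
    then show ?thesis by (intro runs_mono[OF run]) simp_all
  qed
  have loop: "runs B (WhileLess rZERO rGO (Seq find_lowest next_term)) ((\<mu> + 1) * (?m + 1) + 1) answer s'"
    if "inv [(b0, d0)] s' \<and> regs s' rGO = 1" for s'
  proof (rule runs_WhileLess[where I = I and V = V])
    have "good b0 d0 [(b0, d0)]" by (rule good_init[OF b0 d0A])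
    then show "I s'" using that by (auto simp: I_def)
    show "V s' \<le> \<mu> + 1" using that by (simp add: V_def inv_def)
  next
    fix s assume I: "I s"
    then show "small B (regs s rZERO) \<or> small B (regs s rGO)" by (auto simp: I_def)
    show "runs B (Seq find_lowest next_term) ?m (\<lambda>s''. I s'' \<and> V s'' < V s) s" if "regs s rZERO < regs s rGO"
      using body[OF I that] .
    show "answer s" if "\<not> regs s rZERO < regs s rGO"
      using I that by (auto simp: I_def inv_def base_def)
  qed
  have "runs B root_loop (2 + ((t * 12 + 6) + ((\<mu> + 1) * (?m + 1) + 1))) answer s"
    unfolding root_loop_def
    by (rule runs_Seq, rule runs_mono[OF init order_refl], rule runs_Seq, rule runs_mono[OF app order_refl],
      assumption, rule loop)
  then show ?thesis by (rule runs_mono) (simp add: algebra_simps)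
qed

end

subsection \<open>The lowest term and the complete program\<close>

text \<open>Bisection keeps \<open>lo ^ r \<le> N < hi ^ r\<close>, starting from \<open>0\<close>
  and \<open>N + 1\<close>. Storing the power of the lower end in \<open>rLOP\<close> turns the
  final exactness test into one comparison.\<close>

definition root_init :: com where
  "root_init = block [
     IfLess rC0 rZERO (Op Sub rN rZERO rC0) (Op Add rN rC0 rZERO),
     Const rLO 0, Const rLOP 0, Op Add rHI rN rONE, Op Sub rGAP rHI rLO, Const rTWO 2]"

definition root_pre :: com where
  "root_pre = block [Op Add rMID rLO rHI, Op Div rMID rMID rTWO, Const rPOW 1, Const rI 0]"

definition pow_body :: com where
  "pow_body = Seq (Op Mul rPOW rPOW rMID) (Op Add rI rI rONE)"

definition root_post :: com where
  "root_post = block [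
     IfLess rN rPOW (Op Add rHI rMID rZERO) (Seq (Op Add rLO rMID rZERO) (Op Add rLOP rPOW rZERO)),
     Op Sub rGAP rHI rLO]"

definition find_root :: com where
  "find_root = Seq root_init
     (WhileLess rONE rGAP (Seq root_pre (Seq (WhileLess rI rR pow_body) root_post)))"

definition parity :: com where
  "parity = block [Op Div rX rR rTWO, Op Mul rX rX rTWO, Op Sub rX rR rX]"

definition sign_and_loop :: com where
  "sign_and_loop = IfLess rC0 rZERO
     (Seq parity (IfLess rX rONE Skip (Seq (Op Sub rB rZERO rLO) root_loop)))
     (Seq (Op Add rB rLO rZERO) root_loop)"

definition main_init :: com where
  "main_init = block [
     Op Add rR (Suc 0) rZERO, Load rC0 aC rZERO, Load rE0 aE rZERO, Const rONE 1,
     Op Div rD rE0 rR, Op Mul rX rD rR]"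

definition main :: com where
  "main = Seq main_init (IfLess rX rE0 Skip (Seq find_root (IfLess rLOP rN Skip sign_and_loop)))"

text \<open>The order of the guards matters: \<open>r\<close> is only compared with short numbers
  until \<open>r < t\<close> is established, and only \<open>main\<close> performs arithmetic on it.
  By \<open>power_params\<close>, failing a guard excludes a root.\<close>

definition program :: com where
  "program = Seq (Const rOUT (-1))
     (IfLess rZERO (Suc 0) (IfLess (Suc 0) rT (IfLess rZERO rMU main Skip) Skip) Skip)"

section \<open>Correctness of the bisection and of the complete program\<close>

lemma floorlog_halve:
  assumes "0 < a" "b \<le> a div 2"
  shows "floorlog 2 b < floorlog 2 a"
proof -
  have "floorlog 2 a = floorlog 2 (a div 2) + 1"
    using assms(1) by (subst compute_floorlog) simp
  then show ?thesis using floorlog_mono[OF assms(2), of 2] by simp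
qed

context algorithm
begin

text \<open>Plain repeated multiplication is affordable because \<open>r < t\<close>. The powers
  reach \<open>A ^ r\<close>, the reason for \<open>length cs\<close> in the bound on
  \<open>B\<close>.\<close>

lemma pow_loop_runs:
  assumes s: "base s" "regs s rMID = x" "0 \<le> x" "x \<le> A" "regs s rPOW = 1" "regs s rI = 0"
  shows "runs B (WhileLess rI rR pow_body) (t * 3 + 1)
    (\<lambda>s'. unchanged {rPOW, rI} s s' \<and> regs s' rPOW = x ^ r) s"
proof -
  have xA: "\<bar>x ^ k\<bar> \<le> A ^ k" for k
    using s by (simp add: power_abs power_mono)
  have sx: "small B (x ^ k)" if "k \<le> r" for k
    by (rule small_if_le_power[OF xA]) (use that r in simp)
  have sx1: "small B x" using s by (intro small_if_le) simp
  define I where "I k s' \<longleftrightarrow> unchanged {rPOW, rI} s s' \<and> regs s' rPOW = x ^ k \<and> regs s' rI = int k"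
    for k s'
  have body: "runs B pow_body 2 (I (Suc k)) s'" if k: "k < r" and s': "I k s'" for k s'
  proof -
    have "small B (int k)" using small_index k r by simp
    then have "wp B pow_body (I (Suc k)) s'"
      using s' k sx1 sx[of k] s unfolding pow_body_def
      by (simp add: I_def unchanged_def base_def mult.commute)
    from runs_wp[OF this] show ?thesis by (simp add: pow_body_def numeral_2_eq_2)
  qed
  have "runs B (WhileLess rI rR pow_body) (r * (2 + 1) + 1)
    (\<lambda>s'. unchanged {rPOW, rI} s s' \<and> regs s' rPOW = x ^ r) s"
  proof (rule runs_count[where I = I])
    show "I 0 s" using s by (simp add: I_def unchanged_def)
    show "small B (int r)" by simp
    show "regs s' rI = int k \<and> regs s' rR = int r" if "I k s'" for k s'
      using that s by (simp add: I_def unchanged_def base_def)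
    show "unchanged {rPOW, rI} s s' \<and> regs s' rPOW = x ^ r" if "I r s'" for s'
      using that by (simp add: I_def)
  qed (rule body)
  then show ?thesis by (rule runs_mono) (use r in auto)
qed

lemma find_root_runs:
  assumes s: "base s"
  shows "runs B find_root (L * (t * 3 + 11) + 9)
    (\<lambda>s'. unchanged {rI, rN, rLO, rHI, rGAP, rMID, rPOW, rLOP, rTWO} s s' \<and>
      regs s' rN = \<bar>c0\<bar> \<and> regs s' rTWO = 2 \<and> 0 \<le> regs s' rLO \<and> regs s' rLO \<le> A \<and>
      regs s' rLOP = regs s' rLO ^ r \<and> regs s' rLO ^ r \<le> \<bar>c0\<bar> \<and> \<bar>c0\<bar> < (regs s' rLO + 1) ^ r) s"
proof -
  let ?X = "{rI, rN, rLO, rHI, rGAP, rMID, rPOW, rLOP, rTWO} :: reg set"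
  let ?N = "\<bar>c0\<bar>"
  define I where "I s' \<longleftrightarrow> unchanged ?X s s' \<and> regs s' rN = ?N \<and> regs s' rTWO = 2 \<and>
    0 \<le> regs s' rLO \<and> regs s' rLO < regs s' rHI \<and> regs s' rHI \<le> ?N + 1 \<and>
    regs s' rLOP = regs s' rLO ^ r \<and> regs s' rLO ^ r \<le> ?N \<and> ?N < regs s' rHI ^ r \<and>
    regs s' rGAP = regs s' rHI - regs s' rLO" for s'
  \<comment> \<open>The gap itself may be halved upwards, as from 3 to 2, without losing a bit. The
    gap minus one is at most halved rounding down, so its bit length drops in every round.\<close>
  define V where "V s' = floorlog 2 (nat (regs s' rGAP - 1))" for s' :: state
  have A2: "A * 2 \<le> A ^ 2" using A by (simp add: power2_eq_square)
  have small2: "small B x" if "\<bar>x\<bar> \<le> A * 2" for x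
    by (rule small_if_le_power[of _ 2]) (use that A2 in auto)
  have sc0: "small B c0" "small B (- c0)" using first_le(1) by (auto intro!: small_if_le)
  have N0: "0 < ?N" using f_low(3) by simp
  have init: "runs B root_init 7 I s"
  proof -
    have "1 \<le> (?N + 1) ^ (r - 1)" by simp
    then have "(?N + 1) * 1 \<le> (?N + 1) * (?N + 1) ^ (r - 1)" by (rule mult_left_mono) simp
    then have hi: "?N < (?N + 1) ^ r" using r by (simp flip: power_Suc)
    have "small B ?N" "small B (?N + 1)" using first_le(1) A by (auto intro!: small2)
    then have "wp B root_init I s"
      using s sc0 hi r N0 unfolding root_init_def
      by (auto simp: I_def base_def unchanged_def abs_if power_0_left split: if_splits)
    from runs_wp[OF this] show ?thesis by (rule runs_mono) (simp_all add: root_init_def)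
  qed
  have body: "runs B (Seq root_pre (Seq (WhileLess rI rR pow_body) root_post)) (t * 3 + 10)
      (\<lambda>s''. I s'' \<and> V s'' < V s') s'" if I: "I s'" and gap: "regs s' rONE < regs s' rGAP" for s'
  proof -
    define lo hi where "lo = regs s' rLO" and "hi = regs s' rHI"
    define mid where "mid = (lo + hi) div 2"
    have base': "regs s' rONE = 1" "regs s' rZERO = 0" "base s'"
      using I s by (simp_all add: I_def unchanged_def base_def)
    have lh: "0 \<le> lo" "lo + 1 < hi" "hi \<le> ?N + 1" "regs s' rGAP = hi - lo"
      using I gap base' by (auto simp: I_def lo_def hi_def)
    then have mid: "lo < mid" "mid < hi" by (auto simp: mid_def)
    have midA: "mid \<le> A" using mid lh first_le(1) by linarith
    let ?s1 = "s'\<lparr>regs := (regs s')(rMID := mid, rPOW := 1, rI := 0)\<rparr>"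
    have sm: "small B lo" "small B hi" "small B mid" "small B (lo + hi)" "small B ?N"
      using lh mid midA first_le(1) A by (auto intro!: small2)
    have "wp B root_pre (\<lambda>s''. s'' = ?s1) s'"
      using I sm unfolding root_pre_def
      by (simp add: I_def mid_def flip: lo_def hi_def)
    from runs_wp[OF this] have pre: "runs B root_pre 4 (\<lambda>s''. s'' = ?s1) s'"
      by (rule runs_mono) (simp_all add: root_pre_def)
    have "base ?s1" using base'(3) by (simp add: base_def)
    then have loop: "runs B (WhileLess rI rR pow_body) (t * 3 + 1)
      (\<lambda>s''. unchanged {rPOW, rI} ?s1 s'' \<and> regs s'' rPOW = mid ^ r) ?s1"
      by (rule pow_loop_runs) (use mid lh midA in auto)
    have smr: "small B (mid ^ r)"
      by (rule small_if_le_power[of _ r]) (use mid lh midA r in \<open>auto simp: power_abs power_mono\<close>)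
    have post: "runs B root_post 4 (\<lambda>s''. I s'' \<and> V s'' < V s') s2"
      if s2: "unchanged {rPOW, rI} ?s1 s2 \<and> regs s2 rPOW = mid ^ r" for s2
    proof -
      have regs: "regs s2 rN = ?N" "regs s2 rPOW = mid ^ r" "regs s2 rMID = mid" "regs s2 rZERO = 0"
        "regs s2 rLO = lo" "regs s2 rHI = hi" "regs s2 rLOP = lo ^ r" "regs s2 rTWO = 2"
        using s2 I base' by (simp_all add: unchanged_def I_def lo_def hi_def)
      have un: "unchanged ?X s s2" using s2 I by (auto simp: unchanged_def I_def)
      have un': "unchanged ?X s s3" if "arrs s3 = arrs s2" "\<forall>x. x \<notin> ?X \<longrightarrow> regs s3 x = regs s2 x" for s3
        using un that unfolding unchanged_def by simp
      let ?hi = "if ?N < mid ^ r then mid else hi" and ?lo = "if ?N < mid ^ r then lo else mid"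
      let ?P = "\<lambda>s3. arrs s3 = arrs s2 \<and> (\<forall>x. x \<notin> ?X \<longrightarrow> regs s3 x = regs s2 x) \<and>
        regs s3 rN = ?N \<and> regs s3 rTWO = 2 \<and> regs s3 rHI = ?hi \<and> regs s3 rLO = ?lo \<and>
        regs s3 rLOP = ?lo ^ r \<and> regs s3 rGAP = ?hi - ?lo"
      have "wp B root_post ?P s2"
        using sm smr regs unfolding root_post_def by simp
      then have "runs B root_post (steps root_post) ?P s2" by (rule runs_wp)
      then show ?thesis
      proof (rule runs_mono)
        fix s3 :: state assume s3: "?P s3"
        have "I s3" unfolding I_def
          using un'[of s3] s3 mid lh I by (auto simp: I_def lo_def hi_def)
        moreover have "nat (regs s3 rGAP - 1) \<le> nat (regs s' rGAP - 1) div 2"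
        proof -
          have "?hi - ?lo - 1 \<le> (hi - lo - 1) div 2" by (auto simp: mid_def)
          then show ?thesis using s3 lh by (simp add: nat_div_distrib nat_le_iff)
        qed
        then have "V s3 < V s'" unfolding V_def using lh by (intro floorlog_halve) auto
        ultimately show "I s3 \<and> V s3 < V s'" by blast
      qed (simp add: root_post_def)
    qed
    have "runs B (Seq root_pre (Seq (WhileLess rI rR pow_body) root_post)) (4 + ((t * 3 + 1) + 4))
      (\<lambda>s''. I s'' \<and> V s'' < V s') s'"
    proof (rule runs_Seq, rule runs_mono[OF pre order_refl])
      have "runs B (Seq (WhileLess rI rR pow_body) root_post) ((t * 3 + 1) + 4) (\<lambda>s''. I s'' \<and> V s'' < V s') ?s1"
        by (rule runs_Seq, rule runs_mono[OF loop order_refl], rule post)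
      then show "runs B (Seq (WhileLess rI rR pow_body) root_post) ((t * 3 + 1) + 4)
        (\<lambda>s''. I s'' \<and> V s'' < V s') s''" if "s'' = ?s1" for s'' using that by (simp only:)
    qed
    then show ?thesis by (rule runs_mono) auto
  qed
  let ?Q = "\<lambda>s'. unchanged ?X s s' \<and>
      regs s' rN = \<bar>c0\<bar> \<and> regs s' rTWO = 2 \<and> 0 \<le> regs s' rLO \<and> regs s' rLO \<le> A \<and>
      regs s' rLOP = regs s' rLO ^ r \<and> regs s' rLO ^ r \<le> \<bar>c0\<bar> \<and> \<bar>c0\<bar> < (regs s' rLO + 1) ^ r"
  have loop: "runs B (WhileLess rONE rGAP (Seq root_pre (Seq (WhileLess rI rR pow_body) root_post)))
    (L * ((t * 3 + 10) + 1) + 1) ?Q s'" if I: "I s'" for s'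
  proof (rule runs_WhileLess[where I = I and V = V])
    show "I s'" by fact
    have "regs s' rGAP - 1 < 2 ^ L" using I first_le(1) A_L by (auto simp: I_def)
    then have "nat (regs s' rGAP - 1) < 2 ^ L" by (simp add: nat_less_iff)
    then show "V s' \<le> L" unfolding V_def by (rule floorlog_leI) simp_all
  next
    fix s1 assume I: "I s1"
    have one: "regs s1 rONE = 1" using I s by (simp add: I_def unchanged_def base_def)
    show "small B (regs s1 rONE) \<or> small B (regs s1 rGAP)" using one by simp
    show "?Q s1" if "\<not> regs s1 rONE < regs s1 rGAP"
    proof -
      have "regs s1 rHI = regs s1 rLO + 1" using that I one by (simp add: I_def)
      then show ?thesis using I first_le(1) by (auto simp: I_def)
    qed
  qed (rule body)
  have "runs B find_root (7 + (L * ((t * 3 + 10) + 1) + 1)) ?Q s"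
    unfolding find_root_def by (rule runs_Seq, rule runs_mono[OF init order_refl], rule loop)
  then show ?thesis by (rule runs_mono) (simp_all add: algebra_simps)
qed

lemma base_unchanged:
  assumes "unchanged X s s'" "base s" "X \<inter> {rT, rMU, rR, rZERO, rONE, rC0, rE0, rOUT} = {}"
  shows "base s'"
proof -
  have "\<forall>x\<in>{rT, rMU, rR, rZERO, rONE, rC0, rE0, rOUT}. regs s' x = regs s x"
    using assms(1,3) unfolding unchanged_def by blast
  moreover have "arrs s' = arrs s" using assms(1) by (simp add: unchanged_def)
  ultimately show ?thesis using assms(2) by (simp add: base_def)
qed

definition "loop_steps = t * 12 + 9 + (\<mu> + 1) * (\<mu> * t * (\<mu> * t * 8 + 14) + t * 12 + 22)"

text \<open>A negative \<open>c0\<close> has no root for even \<open>r\<close> and the root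
  \<open>- x\<close> for odd \<open>r\<close>. For positive \<open>c0\<close> the root
  \<open>x\<close> alone is tried, which suffices by \<open>root_sign\<close>.\<close>

lemma sign_and_loop_runs:
  assumes s: "base s" "regs s rTWO = 2" "regs s rLO = x" "0 \<le> x" "x \<le> A" "x ^ r = \<bar>c0\<bar>"
    and d: "regs s rD = int d0" "r * d0 = e0"
  shows "runs B sign_and_loop (loop_steps + 6) answer s"
proof -
  have sc0: "small B c0" using first_le(1) by (intro small_if_le)
  have sx: "small B x" using s by (intro small_if_le) simp
  have "runs B sign_and_loop (Suc (loop_steps + 5)) answer s"
    unfolding sign_and_loop_def
  proof (rule runs_IfLess)
    show "small B (regs s rC0) \<or> small B (regs s rZERO)" using s by (simp add: base_def)
  next
    assume "\<not> regs s rC0 < regs s rZERO"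
    then have b0: "x ^ r = c0" using s by (simp add: base_def)
    let ?P = "\<lambda>s'. base s' \<and> regs s' rB = x \<and> regs s' rD = int d0"
    have "wp B (Op Add rB rLO rZERO) ?P s" using s d sx by (simp add: base_def)
    from runs_wp[OF this] have 1: "runs B (Op Add rB rLO rZERO) 1 ?P s" by simp
    have "runs B (Seq (Op Add rB rLO rZERO) root_loop) (1 + loop_steps) answer s"
      by (rule runs_Seq, rule runs_mono[OF 1 order_refl])
        (use root_loop_runs[OF b0 d(2)] in \<open>simp add: loop_steps_def\<close>)
    then show "runs B (Seq (Op Add rB rLO rZERO) root_loop) (loop_steps + 5) answer s"
      by (rule runs_mono) auto
  next
    assume "regs s rC0 < regs s rZERO"
    then have neg: "c0 < 0" using s by (simp add: base_def)
    let ?P = "\<lambda>s'. base s' \<and> regs s' rLO = x \<and> regs s' rD = int d0 \<and> regs s' rX = int (r mod 2)"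
    have mod: "int r - int r div 2 * 2 = int (r mod 2)"
      by (simp add: minus_div_mult_eq_mod of_nat_mod)
    have "small B (int r div 2)" "small B (int r div 2 * 2)"
      using r length_le by (auto intro!: small_if_le)
    then have "wp B parity ?P s" using s d mod unfolding parity_def by (simp add: base_def)
    from runs_wp[OF this] have par: "runs B parity 3 ?P s" by (rule runs_mono) (simp_all add: parity_def)
    have rest: "runs B (IfLess rX rONE Skip (Seq (Op Sub rB rZERO rLO) root_loop)) (Suc (loop_steps + 1)) answer s'"
      if s': "?P s'" for s'
    proof (rule runs_IfLess)
      show "small B (regs s' rX) \<or> small B (regs s' rONE)" using s' by (simp add: base_def)
    next
      assume "regs s' rX < regs s' rONE"
      then have "even r" using s' by (simp add: base_def even_iff_mod_2_eq_zero)
      have "\<not> (\<exists>h. f = h ^ r \<and> sparse \<mu> h)"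
      proof
        assume "\<exists>h. f = h ^ r \<and> sparse \<mu> h"
        then obtain h where "f = h ^ r" by blast
        then obtain d where "coeff h d ^ r = c0" by (rule root_low)
        then show False using neg \<open>even r\<close> zero_le_even_power[of r "coeff h d"] by simp
      qed
      then have "wp B Skip answer s'" using s' answer_failure[of s'] by (simp add: base_def)
      from runs_wp[OF this] show "runs B Skip (loop_steps + 1) answer s'" by (rule runs_mono) auto
    next
      assume "\<not> regs s' rX < regs s' rONE"
      then have "odd r" using s' by (auto simp: base_def even_iff_mod_2_eq_zero)
      then have b0: "(- x) ^ r = c0" using s(6) neg by (simp add: power_minus_odd)
      let ?R = "\<lambda>s'. base s' \<and> regs s' rB = - x \<and> regs s' rD = int d0"
      have "wp B (Op Sub rB rZERO rLO) ?R s'" using s' sx by (simp add: base_def)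
      from runs_wp[OF this] have 1: "runs B (Op Sub rB rZERO rLO) 1 ?R s'" by simp
      have "runs B (Seq (Op Sub rB rZERO rLO) root_loop) (1 + loop_steps) answer s'"
        by (rule runs_Seq, rule runs_mono[OF 1 order_refl])
          (use root_loop_runs[OF b0 d(2)] in \<open>simp add: loop_steps_def\<close>)
      then show "runs B (Seq (Op Sub rB rZERO rLO) root_loop) (loop_steps + 1) answer s'"
        by (rule runs_mono) auto
    qed
    have "runs B (Seq parity (IfLess rX rONE Skip (Seq (Op Sub rB rZERO rLO) root_loop)))
      (3 + Suc (loop_steps + 1)) answer s"
      by (rule runs_Seq, rule runs_mono[OF par order_refl], rule rest)
    then show "runs B (Seq parity (IfLess rX rONE Skip (Seq (Op Sub rB rZERO rLO) root_loop)))
      (loop_steps + 5) answer s" by (rule runs_mono) auto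
  qed
  then show ?thesis by (rule runs_mono) auto
qed

lemma main_runs:
  assumes s: "regs s rT = int t" "regs s (Suc 0) = int r" "regs s rMU = int \<mu>" "regs s rOUT = -1"
    "regs s rZERO = 0"
    "\<And>i. i < t \<Longrightarrow> arrs s aC (int i) = fst (cs ! i) \<and> arrs s aE (int i) = int (snd (cs ! i))"
  shows "runs B main (L * (t * 3 + 11) + loop_steps + 23) answer s"
proof -
  have se0: "small B (int e0)" "small B c0" using first_le by (auto intro!: small_if_le)
  let ?d0 = "e0 div r"
  have "?d0 \<le> e0" by simp
  then have d0A: "int ?d0 \<le> A" using first_le(2) by linarith
  have xA: "?d0 * r \<le> e0" by simp
  have "0 < t" using length_ge by linarith
  from s(6)[OF this] have e0: "arrs s aC 0 = c0" "arrs s aE 0 = int e0" by simp_all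
  have init: "runs B main_init 6
    (\<lambda>s'. base s' \<and> regs s' rD = int ?d0 \<and> regs s' rX = int (?d0 * r)) s"
  proof -
    have "small B (int ?d0)" using d0A by (intro small_if_le) simp
    then have "wp B main_init (\<lambda>s'. base s' \<and> regs s' rD = int ?d0 \<and> regs s' rX = int (?d0 * r)) s"
      using s e0 se0 unfolding main_init_def by (simp add: base_def of_nat_div)
    from runs_wp[OF this] show ?thesis by (rule runs_mono) (simp_all add: main_init_def)
  qed
  let ?X = "{rI, rN, rLO, rHI, rGAP, rMID, rPOW, rLOP, rTWO} :: reg set"
  have rest: "runs B (IfLess rX rE0 Skip (Seq find_root (IfLess rLOP rN Skip sign_and_loop)))
    (Suc (L * (t * 3 + 11) + loop_steps + 16)) answer s1"
    if s1: "base s1 \<and> regs s1 rD = int ?d0 \<and> regs s1 rX = int (?d0 * r)" for s1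
  proof (rule runs_IfLess)
    show "small B (regs s1 rX) \<or> small B (regs s1 rE0)" using s1 se0 by (simp add: base_def)
  next
    assume "regs s1 rX < regs s1 rE0"
    then have ne: "?d0 * r \<noteq> e0" using s1 by (auto simp: base_def simp flip: of_nat_mult)
    have "\<not> (\<exists>h. f = h ^ r \<and> sparse \<mu> h)"
    proof
      assume "\<exists>h. f = h ^ r \<and> sparse \<mu> h"
      then obtain h where "f = h ^ r" by blast
      then obtain d where "r * d = e0" by (rule root_low)
      with ne show False by (metis dvd_div_mult_self dvd_triv_left)
    qed
    then have "wp B Skip answer s1" using s1 answer_failure[of s1] by (simp add: base_def)
    from runs_wp[OF this] show "runs B Skip (L * (t * 3 + 11) + loop_steps + 16) answer s1"
      by (rule runs_mono) auto
  next
    assume "\<not> regs s1 rX < regs s1 rE0"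
    then have "e0 \<le> ?d0 * r" using s1 by (simp add: base_def not_less flip: of_nat_mult)
    with xA have "?d0 * r = e0" by (rule antisym)
    then have d0: "r * ?d0 = e0" by (simp only: mult.commute)
    have base1: "base s1" using s1 by simp
    let ?P = "\<lambda>s'. unchanged ?X s1 s' \<and>
      regs s' rN = \<bar>c0\<bar> \<and> regs s' rTWO = 2 \<and> 0 \<le> regs s' rLO \<and> regs s' rLO \<le> A \<and>
      regs s' rLOP = regs s' rLO ^ r \<and> regs s' rLO ^ r \<le> \<bar>c0\<bar> \<and> \<bar>c0\<bar> < (regs s' rLO + 1) ^ r"
    have last: "runs B (IfLess rLOP rN Skip sign_and_loop) (Suc (loop_steps + 6)) answer s2"
      if s2: "?P s2" for s2
    proof (rule runs_IfLess)
      have base2: "base s2" by (rule base_unchanged[OF conjunct1[OF s2] base1]) simp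
      have "regs s2 rN = \<bar>c0\<bar>" using s2 by blast
      then show "small B (regs s2 rLOP) \<or> small B (regs s2 rN)"
        using first_le(1) by (auto intro!: small_if_le)
      show "runs B Skip (loop_steps + 6) answer s2" if lt: "regs s2 rLOP < regs s2 rN"
      proof -
        have "\<not> (\<exists>h. f = h ^ r \<and> sparse \<mu> h)"
        proof
          assume "\<exists>h. f = h ^ r \<and> sparse \<mu> h"
          then obtain h where "f = h ^ r" by blast
          then obtain d where "coeff h d ^ r = c0" by (rule root_low)
          then have y: "\<bar>c0\<bar> = \<bar>coeff h d\<bar> ^ r" by (simp flip: power_abs)
          \<comment> \<open>The coefficient of a root would have its absolute value strictly between
            two consecutive integers.\<close>
          have "regs s2 rLO ^ r < \<bar>coeff h d\<bar> ^ r" "\<bar>coeff h d\<bar> ^ r < (regs s2 rLO + 1) ^ r"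
            using s2 lt by (simp_all flip: y)
          then have "regs s2 rLO < \<bar>coeff h d\<bar>" "\<bar>coeff h d\<bar> < regs s2 rLO + 1"
            using s2 by (auto dest!: power_less_imp_less_base)
          then show False by simp
        qed
        then have "wp B Skip answer s2" using base2 answer_failure[of s2] by (simp add: base_def)
        from runs_wp[OF this] show ?thesis by (rule runs_mono) auto
      qed
      show "runs B sign_and_loop (loop_steps + 6) answer s2" if "\<not> regs s2 rLOP < regs s2 rN"
      proof (rule sign_and_loop_runs[OF base2 _ refl _ _ _ _ d0])
        show "regs s2 rTWO = 2" "0 \<le> regs s2 rLO" "regs s2 rLO \<le> A" using s2 by simp_all
        show "regs s2 rLO ^ r = \<bar>c0\<bar>" using s2 that by linarith
        show "regs s2 rD = int ?d0" using s2 s1 by (simp add: unchanged_def)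
      qed
    qed
    have "runs B (Seq find_root (IfLess rLOP rN Skip sign_and_loop))
      ((L * (t * 3 + 11) + 9) + Suc (loop_steps + 6)) answer s1"
      by (rule runs_Seq, rule runs_mono[OF find_root_runs[OF base1] order_refl], rule last)
    then show "runs B (Seq find_root (IfLess rLOP rN Skip sign_and_loop))
      (L * (t * 3 + 11) + loop_steps + 16) answer s1" by (rule runs_mono) auto
  qed
  have "runs B main (6 + (Suc (L * (t * 3 + 11) + loop_steps + 16))) answer s"
    unfolding main_def by (rule runs_Seq, rule runs_mono[OF init order_refl], rule rest)
  then show ?thesis by (rule runs_mono) auto
qed

end

section \<open>Polynomial bounds in a single parameter\<close>

text \<open>The dominant product has the shape \<open>\<mu> * (\<mu> * t)\<^sup>2\<close>, of degree
  5 in \<open>Y\<close>; lower powers are absorbed generously.\<close>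

lemma steps_bound:
  fixes t \<mu> Y :: nat
  assumes "2 \<le> Y" "t \<le> Y" "\<mu> \<le> Y"
  shows "(2 * Y + 1) * (t * 3 + 11) +
    (t * 12 + 9 + (\<mu> + 1) * (\<mu> * t * (\<mu> * t * 8 + 14) + t * 12 + 22)) + 30 \<le> 300 * Y ^ 5"
proof -
  have m: "\<mu> * t \<le> Y * Y" using assms by (intro mult_le_mono)
  have p: "Y ^ i \<le> Y ^ j" if "i \<le> j" for i j using assms that by (simp add: power_increasing)
  have p': "1 \<le> Y ^ 5" "Y \<le> Y ^ 5" "Y ^ 2 \<le> Y ^ 5" "Y \<le> Y ^ 4" "Y ^ 2 \<le> Y ^ 4" "1 \<le> Y ^ 4" "Y \<le> Y ^ 2"
    using p[of 0 5] p[of 1 5] p[of 2 5] p[of 1 4] p[of 2 4] p[of 0 4] p[of 1 2] by simp_all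
  have "\<mu> * t * (\<mu> * t * 8 + 14) \<le> Y * Y * (Y * Y * 8 + 14)"
    by (rule mult_le_mono[OF m add_le_mono1[OF mult_le_mono1[OF m]]])
  also have "\<dots> = 8 * Y ^ 4 + 14 * Y ^ 2" by (simp add: algebra_simps power4_eq_xxxx power2_eq_square)
  finally have "\<mu> * t * (\<mu> * t * 8 + 14) + t * 12 + 22 \<le> 56 * Y ^ 4"
    using p' assms by linarith
  moreover have "\<mu> + 1 \<le> 2 * Y" using assms by linarith
  ultimately have "(\<mu> + 1) * (\<mu> * t * (\<mu> * t * 8 + 14) + t * 12 + 22) \<le> 2 * Y * (56 * Y ^ 4)"
    by (intro mult_le_mono)
  also have "\<dots> = 112 * Y ^ 5" by (simp add: power_numeral_reduce)
  finally have 1: "(\<mu> + 1) * (\<mu> * t * (\<mu> * t * 8 + 14) + t * 12 + 22) \<le> 112 * Y ^ 5" .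
  have "(2 * Y + 1) * (t * 3 + 11) \<le> (3 * Y) * (14 * Y)" using assms by (intro mult_le_mono) auto
  also have "\<dots> = 42 * Y ^ 2" by (simp add: power2_eq_square)
  finally show ?thesis using 1 p' assms by linarith
qed

lemma bits_bound:
  fixes Y :: nat
  assumes "2 \<le> Y"
  shows "(2 * Y * (20 * Y + 40) + 1 + 2)\<^sup>2 \<le> 10000 * Y ^ 4"
proof -
  have 1: "2 * Y \<le> Y * Y" using assms by simp
  have "2 * Y * (20 * Y + 40) + 1 + 2 = 40 * (Y * Y) + 80 * Y + 3" by (simp add: algebra_simps)
  also have "\<dots> \<le> 100 * (Y * Y)" using 1 assms by linarith
  finally have "2 * Y * (20 * Y + 40) + 1 + 2 \<le> 100 * (Y * Y)" .
  then have "(2 * Y * (20 * Y + 40) + 1 + 2)\<^sup>2 \<le> (100 * (Y * Y))\<^sup>2" by (rule power_mono) simp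
  also have "\<dots> = 10000 * Y ^ 4" by (simp add: power2_eq_square power4_eq_xxxx)
  finally show ?thesis .
qed

lemma power_params:
  fixes f h :: "int poly"
  assumes "2 \<le> num_terms f" "f = h ^ r" "sparse \<mu> h"
  shows "0 < r" "r < num_terms f" "0 < \<mu>"
proof -
  note h = two_le_num_terms_power[of h r]
  show "0 < r" "0 < \<mu>" using h assms by (auto simp: sparse_def)
  have "f \<noteq> 0" using assms(1) num_terms_eq_0_iff[of f] by auto
  then show "r < num_terms f"
    using less_num_terms_if_power_dvd[of h r f] h(1) assms(1,2) by auto
qed

text \<open>With \<open>A = 4 ^ Y = 2 ^ (2 * Y)\<close>, the required power of \<open>A\<close> is
  \<open>2 ^ (2 * Y * (20 * \<mu> + t + 40))\<close>, and
  \<open>20 * \<mu> + t \<le> 20 * Y\<close>. The last \<open>+ 1\<close> in the bit bound makes the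
  inequality strict.\<close>

lemma program_runs:
  fixes f :: "int poly" and r \<mu> Y :: nat
  defines "t \<equiv> num_terms f"
  assumes Y: "2 \<le> t" "t + \<mu> \<le> Y" "degree f \<le> 2 ^ Y" "max_norm f \<le> 2 ^ Y"
  shows "runs (2 * Y * (20 * Y + 40) + 1) program (300 * Y ^ 5)
    (\<lambda>s. if \<exists>h. f = h ^ r \<and> sparse \<mu> h
         then \<exists>h. f = h ^ r \<and> sparse \<mu> h \<and> returns s (lacunary h)
         else reports_failure s) (input_state (lacunary f) r \<mu>)"
    (is "runs ?B _ _ ?Q ?s")
proof -
  let ?cs = "lacunary f"
  \<comment> \<open>\<open>4 ^ Y\<close> dominates \<open>2 ^ Y\<close>, the bound on exponents and
    coefficients, and also \<open>Y\<close>, which bounds \<open>t\<close> and, as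
    \<open>2 \<le> t\<close>, also \<open>\<mu> + 2\<close>.\<close>
  let ?A = "4 ^ Y :: int" and ?L = "2 * Y + 1"
  let ?s1 = "?s\<lparr>regs := (regs ?s)(rOUT := -1)\<rparr>"
  have len: "length ?cs = t" by (simp add: t_def length_lacunary)
  have Y2: "2 \<le> Y" using Y by linarith
  have A_eq: "?A = 2 ^ (2 * Y)" by (simp add: power_mult)
  have two4: "(2 :: int) ^ Y \<le> 4 ^ Y" by (simp add: power_mono)
  have "int Y \<le> int (2 ^ Y)" using less_exp[of Y] by (simp only: of_nat_le_iff less_imp_le)
  then have Y4: "int Y \<le> ?A" using two4 by simp
  have small: "small ?B 0" "small ?B (-1)" "small ?B (int t)"
  proof -
    have "2 * Y * 1 \<le> 2 * Y * (20 * Y + 40)" by (rule mult_le_mono2) simp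
    then have "(2 :: int) ^ (2 * Y + 1) \<le> 2 ^ ?B" by (intro power_increasing) simp_all
    then have "2 * ?A \<le> 2 ^ ?B" by (simp add: A_eq)
    moreover have "int t \<le> ?A" "2 \<le> ?A" using Y4 Y by linarith+
    ultimately show "small ?B 0" "small ?B (-1)" "small ?B (int t)"
      unfolding small_def by linarith+
  qed
  have s1: "regs ?s1 rT = int t" "regs ?s1 (Suc 0) = int r" "regs ?s1 rMU = int \<mu>" "regs ?s1 rOUT = -1"
    "regs ?s1 rZERO = 0"
    "\<And>i. i < length ?cs \<Longrightarrow> arrs ?s1 aC (int i) = fst (?cs ! i) \<and> arrs ?s1 aE (int i) = int (snd (?cs ! i))"
    by (simp_all add: input_state_def len)
  let ?W = "?L * (t * 3 + 11) + (t * 12 + 9 + (\<mu> + 1) * (\<mu> * t * (\<mu> * t * 8 + 14) + t * 12 + 22)) + 23"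
  have fail: "runs ?B Skip m ?Q ?s1" if "\<not> (\<exists>h. f = h ^ r \<and> sparse \<mu> h)" "0 < m" for m
  proof -
    have "?Q ?s1" unfolding if_not_P[OF that(1)] using s1(4) by (simp add: reports_failure_def)
    then have "wp ?B Skip ?Q ?s1" by simp
    from runs_wp[OF this] show ?thesis by (rule runs_mono) (use that(2) in auto)
  qed
  have main: "runs ?B main ?W ?Q ?s1" if rm: "0 < r" "r < t" "0 < \<mu>"
  proof -
    interpret algorithm ?cs r \<mu> ?B ?L ?A
    proof
      show "2 \<le> ?A" using Y4 Y2 by linarith
      show "?A < 2 ^ ?L" by (simp add: A_eq)
      show "int (length ?cs) \<le> ?A" "int \<mu> + 2 \<le> ?A" using Y4 Y len by linarith+
      show "reduced ?cs" by (rule reduced_lacunary)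
      show "2 \<le> length ?cs" "0 < r" "r < length ?cs" "0 < \<mu>" using rm Y len by simp_all
      show "\<bar>c\<bar> \<le> ?A \<and> int e \<le> ?A" if "(c, e) \<in> set ?cs" for c e
      proof -
        have c: "c = coeff f e" "c \<noteq> 0" using that by (auto simp: set_lacunary)
        then have e: "e \<le> degree f" by (simp add: le_degree)
        then have "\<bar>c\<bar> \<le> max_norm f" unfolding max_norm_def c(1) by (intro Max_ge) auto
        moreover have "int e \<le> int (2 ^ Y)" using e Y(3) unfolding of_nat_le_iff by (rule le_trans)
        then have "int e \<le> 2 ^ Y" unfolding of_nat_power of_nat_numeral .
        ultimately show ?thesis using Y(4) two4 by (intro conjI) linarith+
      qed
      have "2 * Y * (20 * \<mu> + length ?cs + 40) \<le> 2 * Y * (20 * Y + 40)"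
        using Y len by (intro mult_le_mono) auto
      then have "(2 :: int) ^ (2 * Y * (20 * \<mu> + length ?cs + 40)) \<le> 2 ^ (2 * Y * (20 * Y + 40))"
        by (intro power_increasing) auto
      also have "\<dots> < 2 ^ ?B" by simp
      finally show "?A ^ (20 * \<mu> + length ?cs + 40) < 2 ^ ?B" unfolding A_eq power_mult[symmetric] .
    qed
    have "answer = ?Q" by (intro ext) (simp only: answer_def poly_of_lacunary)
    with main_runs[of ?s1] s1 show ?thesis by (simp add: loop_steps_def len)
  qed
  let ?ifs = "IfLess rZERO (Suc 0) (IfLess (Suc 0) rT (IfLess rZERO rMU main Skip) Skip) Skip"
  have ifs: "runs ?B ?ifs (Suc (Suc (Suc ?W))) ?Q ?s1"
  proof (rule runs_IfLess, goal_cases)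
    case 2
    then have r0: "0 < r" using s1 by simp
    show ?case
    proof (rule runs_IfLess, goal_cases)
      case 2
      then have rt: "r < t" using s1 by simp
      show ?case
      proof (rule runs_IfLess, goal_cases)
        case 2
        then have "0 < \<mu>" using s1 by simp
        with r0 rt show ?case by (rule main)
      next
        case 3
        then have "\<not> 0 < \<mu>" using s1 by simp
        then show ?case using power_params(3)[OF Y(1)[unfolded t_def]] by (intro fail) auto
      qed (use small s1 in simp)
    next
      case 3
      then have "\<not> r < t" using s1 by simp
      then show ?case using power_params(2)[OF Y(1)[unfolded t_def]] by (intro fail) (auto simp: t_def)
    qed (use small s1 in simp)
  next
    case 3
    then have "\<not> 0 < r" using s1 by simp
    then show ?case using power_params(1)[OF Y(1)[unfolded t_def]] by (intro fail) (blast, simp)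
  qed (use small s1 in simp)
  have "wp ?B (Const rOUT (-1)) (\<lambda>s. s = ?s1) ?s" using small by simp
  from runs_wp[OF this] have out: "runs ?B (Const rOUT (-1)) 1 (\<lambda>s. s = ?s1) ?s" by simp
  have "runs ?B program (1 + Suc (Suc (Suc ?W))) ?Q ?s"
    unfolding program_def by (rule runs_Seq, rule runs_mono[OF out order_refl]) (use ifs in simp)
  then show ?thesis
    by (rule runs_mono) (use steps_bound[of Y t \<mu>] Y in auto)
qed

theorem theorem3p1:
  "\<exists>(P::com) (C::nat) (k::nat). \<forall>(f::int poly) (t::nat) (r::nat) (\<mu>::nat).
     num_terms f = t \<and> t \<ge> 2 \<longrightarrow>
     (\<exists>n s. exec P (input_state (lacunary f) r \<mu>) n s \<and>
        (if \<exists>h::int poly. f = h ^ r \<and> sparse \<mu> h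
         then \<exists>h::int poly. f = h ^ r \<and> sparse \<mu> h \<and> returns s (lacunary h)
         else reports_failure s) \<and>
        real n \<le> real C * (real t + log 2 (real (degree f)) +
                   log 2 (real_of_int (max_norm f)) + real \<mu>) ^ k)"
\<comment> \<open>The constant is 10000 from \<open>bits_bound\<close> times 300 from
  \<open>steps_bound\<close>; \<open>2 ^ 9\<close> pays for rounding the real parameter up to a
  natural number.\<close>
proof (rule exI[of _ program], rule exI[of _ "3000000 * 2 ^ 9"], rule exI[of _ 9], intro allI impI)
  fix f :: "int poly" and t r \<mu> :: nat
  assume "num_terms f = t \<and> t \<ge> 2"
  then have t: "num_terms f = t" "2 \<le> t" by simp_all
  have f0: "f \<noteq> 0" using t num_terms_eq_0_iff[of f] by auto
  obtain e where e: "low e f" "coeff f e \<noteq> 0" using low_exists[OF f0] .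
  \<comment> \<open>Degree and norm are at least 1, so both logarithms are nonnegative and the sum
    bounds each of its summands.\<close>
  have deg: "1 \<le> degree f" using two_le_num_terms_iff[OF e] t by simp
  have "\<bar>coeff f (degree f)\<bar> \<le> max_norm f" unfolding max_norm_def by (intro Max_ge) auto
  moreover have "1 \<le> \<bar>coeff f (degree f)\<bar>" using f0 by (simp add: int_one_le_iff_zero_less)
  ultimately have norm: "1 \<le> max_norm f" by linarith
  let ?ld = "log 2 (real (degree f))" and ?ln = "log 2 (real_of_int (max_norm f))"
  define X where "X = real t + ?ld + ?ln + real \<mu>"
  define Y where "Y = nat \<lceil>X\<rceil>"
  have pos: "0 \<le> ?ld" "0 \<le> ?ln" using deg norm by simp_all
  have XY: "X \<le> real Y" unfolding Y_def by (rule real_nat_ceiling_ge)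
  have X2: "2 \<le> X" using pos t by (simp add: X_def)
  have YX: "real Y \<le> 2 * X" using X2 of_int_ceiling_le_add_one[of X] unfolding Y_def by linarith
  have "?ld \<le> real Y" "?ln \<le> real Y" using XY pos unfolding X_def by linarith+
  then have "real (degree f) \<le> 2 powr real Y" "real_of_int (max_norm f) \<le> 2 powr real Y"
    using deg norm by (simp_all add: log_le_iff)
  then have "real (degree f) \<le> real (2 ^ Y)" "real_of_int (max_norm f) \<le> real_of_int (2 ^ Y)"
    by (simp_all add: powr_realpow)
  then have bounds: "degree f \<le> 2 ^ Y" "max_norm f \<le> 2 ^ Y"
    unfolding of_nat_le_iff of_int_le_iff .
  have "real (t + \<mu>) \<le> real Y" using XY pos by (simp add: X_def)
  then have tY: "t + \<mu> \<le> Y" by (simp only: of_nat_le_iff)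
  then have Y2: "2 \<le> Y" using t by linarith
  let ?B = "2 * Y * (20 * Y + 40) + 1"
  obtain n s where n: "exec program (input_state (lacunary f) r \<mu>) n s"
    "n \<le> (?B + 2)\<^sup>2 * (300 * Y ^ 5)"
    "if \<exists>h. f = h ^ r \<and> sparse \<mu> h
         then \<exists>h. f = h ^ r \<and> sparse \<mu> h \<and> returns s (lacunary h)
         else reports_failure s"
    using program_runs[of f \<mu> Y r] t tY bounds unfolding runs_def by blast
  have "n \<le> 10000 * Y ^ 4 * (300 * Y ^ 5)"
    using n(2) mult_le_mono1[OF bits_bound[OF Y2], of "300 * Y ^ 5"] by linarith
  also have "\<dots> = 3000000 * Y ^ 9" by (simp add: power_numeral_reduce)
  finally have "real n \<le> real (3000000 * Y ^ 9)" by (simp only: of_nat_le_iff)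
  also have "\<dots> = 3000000 * real Y ^ 9" by simp
  also have "\<dots> \<le> 3000000 * (2 * X) ^ 9" by (intro mult_left_mono power_mono YX) auto
  also have "\<dots> = real (3000000 * 2 ^ 9) * X ^ 9" by (simp add: power_mult_distrib)
  finally show "\<exists>n s. exec program (input_state (lacunary f) r \<mu>) n s \<and>
        (if \<exists>h::int poly. f = h ^ r \<and> sparse \<mu> h
         then \<exists>h::int poly. f = h ^ r \<and> sparse \<mu> h \<and> returns s (lacunary h)
         else reports_failure s) \<and>
        real n \<le> real (3000000 * 2 ^ 9) * (real t + ?ld + ?ln + real \<mu>) ^ 9"
    using n(1,3) unfolding X_def by blast
qed

end
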